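(* Let $(\mathfrak{g},\delta_\mathfrak{g})$ be a Lie coalgebra over $k$, let $E$ be a vector space containing $\mathfrak{g}$ as a subspace, and let $V$ be a complement of $\mathfrak{g}$ in $E$. Suppose that there is a Lie coalgebra structure $(E,\delta_E)$ on $E$ such that $(\mathfrak{g},\delta_\mathfrak{g})$ is a Lie sub-coalgebra of $(E,\delta_E)$. Then there exists a Lie coalgebraic extending structure $\Omega^c(\mathfrak{g},\delta_\mathfrak{g},V)=(\Delta_E,\Delta_V,\delta_V)$ of $(\mathfrak{g},\delta_\mathfrak{g})$ by $V$ such that $(E,\delta_E)$ is isomorphic, as a Lie coalgebra, to the unified co-product $\mathfrak{g}\natural^c V$ via an isomorphism whose restriction to $\mathfrak{g}$ is the identity map.
   Context: $k$ is a field of characteristic $0$; all vector spaces and (multi)linear maps are over $k$. $I$ denotes the identity map. A Lie coalgebra $(\mathfrak{g},\delta_\mathfrak{g})$ is a vector space $\mathfrak{g}$ with a linear map $\delta_\mathfrak{g}:\mathfrak{g}\to\mathfrak{g}\otimes\mathfrak{g}$ such that $\delta_\mathfrak{g}=-\tau\delta_\mathfrak{g}$ and $(I\otimes\delta_\mathfrak{g})\delta_\mathfrak{g}-\tau_{12}(I\otimes\delta_\mathfrak{g})\delta_\mathfrak{g}=(\delta_\mathfrak{g}\otimes I)\delta_\mathfrak{g}$, where $\tau(a\otimes b)=b\otimes a$ and $\tau_{12}(a\otimes b\otimes c)=b\otimes a\otimes c$. A homomorphism of Lie coalgebras is a linear map $\varphi$ with $\delta\varphi=(\varphi\otimes\varphi)\delta$.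 $(\mathfrak{g},\delta_\mathfrak{g})$ is a Lie sub-coalgebra of $(E,\delta_E)$ if $\mathfrak{g}\subseteq E$ is a subspace and $\delta_E|_\mathfrak{g}=\delta_\mathfrak{g}$. An extending datum of $(\mathfrak{g},\delta_\mathfrak{g})$ by a vector space $V$ is a triple $\Omega^c(\mathfrak{g},\delta_\mathfrak{g},V)=(\Delta_E,\Delta_V,\delta_V)$ of linear maps $\Delta_E:V\to\mathfrak{g}\otimes V$, $\Delta_V:V\to\mathfrak{g}\otimes\mathfrak{g}$, $\delta_V:V\to V\otimes V$. Given such a datum, $\mathfrak{g}\natural^cV$ denotes the vector space $\mathfrak{g}\oplus V$ with the linear map $\delta(a+x)=\delta_\mathfrak{g}(a)+\Delta_E(x)-\tau\Delta_E(x)+\Delta_V(x)+\delta_V(x)$ for $a\in\mathfrak{g}$, $x\in V$. If $\mathfrak{g}\natural^cV$ is a Lie coalgebra with this co-bracket, it is called the unified co-product of $(\mathfrak{g},\delta_\mathfrak{g})$ and $\Omega^c(\mathfrak{g},\delta_\mathfrak{g},V)$, and the datum is called a Lie coalgebraic extending structure of $(\mathfrak{g},\delta_\mathfrak{g})$ by $V$. *)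

theory Defs
  imports "HOL-Algebra.AbelCoset" "Jordan_Normal_Form.Missing_VectorSpace"
begin

section \<open>Tensor products of vector spaces\<close>

definition quotient_module ::
  "('k, 'm, 'e) module_scheme \<Rightarrow> 'm set \<Rightarrow> ('k, 'm set) module" where
  "quotient_module M N = \<lparr>carrier = a_rcosets\<^bsub>M\<^esub> N,
     mult = (\<lambda>X Y. N), one = N,
     zero = N,
     add = (\<lambda>X Y. X <+>\<^bsub>M\<^esub> Y),
     smult = (\<lambda>c X. \<Union>x\<in>X. N +>\<^bsub>M\<^esub> (c \<odot>\<^bsub>M\<^esub> x))\<rparr>"

text \<open>The fields \<open>mult\<close> and \<open>one\<close> are junk, as in \<^const>\<open>direct_sum\<close>.\<close>

definition free_module :: "('k, 'r) ring_scheme \<Rightarrow> 's set \<Rightarrow> ('k, 's \<Rightarrow> 'k) module" where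
  "free_module K S = (ring.func_space K S)
     \<lparr>carrier := {f \<in> S \<rightarrow>\<^sub>E carrier K. finite {s \<in> S. f s \<noteq> \<zero>\<^bsub>K\<^esub>}}\<rparr>"

definition free_gen :: "('k, 'r) ring_scheme \<Rightarrow> 's set \<Rightarrow> 's \<Rightarrow> 's \<Rightarrow> 'k" where
  "free_gen K S s = (\<lambda>t\<in>S. if t = s then \<one>\<^bsub>K\<^esub> else \<zero>\<^bsub>K\<^esub>)"

definition tensor_relations ::
  "('k, 'r) ring_scheme \<Rightarrow> ('k, 'v, 'e1) module_scheme \<Rightarrow> ('k, 'w, 'e2) module_scheme
     \<Rightarrow> ('v \<times> 'w \<Rightarrow> 'k) set" where
  "tensor_relations K V W =
    (let F = free_module K (carrier V \<times> carrier W);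
         g = (\<lambda>v w. free_gen K (carrier V \<times> carrier W) (v, w))
     in {g (v \<oplus>\<^bsub>V\<^esub> v') w \<ominus>\<^bsub>F\<^esub> (g v w \<oplus>\<^bsub>F\<^esub> g v' w) | v v' w.
           v \<in> carrier V \<and> v' \<in> carrier V \<and> w \<in> carrier W}
      \<union> {g v (w \<oplus>\<^bsub>W\<^esub> w') \<ominus>\<^bsub>F\<^esub> (g v w \<oplus>\<^bsub>F\<^esub> g v w') | v w w'.
           v \<in> carrier V \<and> w \<in> carrier W \<and> w' \<in> carrier W}
      \<union> {g (c \<odot>\<^bsub>V\<^esub> v) w \<ominus>\<^bsub>F\<^esub> (c \<odot>\<^bsub>F\<^esub> g v w) | c v w.
           c \<in> carrier K \<and> v \<in> carrier V \<and> w \<in> carrier W}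
      \<union> {g v (c \<odot>\<^bsub>W\<^esub> w) \<ominus>\<^bsub>F\<^esub> (c \<odot>\<^bsub>F\<^esub> g v w) | c v w.
           c \<in> carrier K \<and> v \<in> carrier V \<and> w \<in> carrier W})"

definition tensor_null ::
  "('k, 'r) ring_scheme \<Rightarrow> ('k, 'v, 'e1) module_scheme \<Rightarrow> ('k, 'w, 'e2) module_scheme
     \<Rightarrow> ('v \<times> 'w \<Rightarrow> 'k) set" where
  "tensor_null K V W =
     module.span K (free_module K (carrier V \<times> carrier W)) (tensor_relations K V W)"

definition tensor ::
  "('k, 'r) ring_scheme \<Rightarrow> ('k, 'v, 'e1) module_scheme \<Rightarrow> ('k, 'w, 'e2) module_scheme
     \<Rightarrow> ('k, ('v \<times> 'w \<Rightarrow> 'k) set) module" where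
  "tensor K V W =
     quotient_module (free_module K (carrier V \<times> carrier W)) (tensor_null K V W)"

definition pure_tensor ::
  "('k, 'r) ring_scheme \<Rightarrow> ('k, 'v, 'e1) module_scheme \<Rightarrow> ('k, 'w, 'e2) module_scheme
     \<Rightarrow> 'v \<Rightarrow> 'w \<Rightarrow> ('v \<times> 'w \<Rightarrow> 'k) set" where
  "pure_tensor K V W v w =
     tensor_null K V W +>\<^bsub>free_module K (carrier V \<times> carrier W)\<^esub>
       free_gen K (carrier V \<times> carrier W) (v, w)"

definition bilinear_map ::
  "('k, 'r) ring_scheme \<Rightarrow> ('k, 'v, 'e1) module_scheme \<Rightarrow> ('k, 'w, 'e2) module_scheme
     \<Rightarrow> ('k, 'p, 'e3) module_scheme \<Rightarrow> ('v \<Rightarrow> 'w \<Rightarrow> 'p) \<Rightarrow> bool" where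
  "bilinear_map K V W P b \<longleftrightarrow>
     (\<forall>v\<in>carrier V. b v \<in> module_hom K W P) \<and>
     (\<forall>w\<in>carrier W. (\<lambda>v. b v w) \<in> module_hom K V P)"

text \<open>The linear map out of a tensor product induced by a bilinear map; its existence and
  uniqueness are \<open>tensor_lift_ex1\<close> below.\<close>

definition tensor_lift ::
  "('k, 'r) ring_scheme \<Rightarrow> ('k, 'v, 'e1) module_scheme \<Rightarrow> ('k, 'w, 'e2) module_scheme
     \<Rightarrow> ('k, 'p, 'e3) module_scheme \<Rightarrow> ('v \<Rightarrow> 'w \<Rightarrow> 'p) \<Rightarrow> ('v \<times> 'w \<Rightarrow> 'k) set \<Rightarrow> 'p" where
  "tensor_lift K V W P b =
     (THE T. T \<in> module_hom K (tensor K V W) P \<and> T \<in> extensional (carrier (tensor K V W)) \<and>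
       (\<forall>v\<in>carrier V. \<forall>w\<in>carrier W. T (pure_tensor K V W v w) = b v w))"

text \<open>\<open>tensor_map K V W V' W' f g\<close> is $f \otimes g : V \otimes W \to V' \otimes W'$.\<close>

definition tensor_map ::
  "('k, 'r) ring_scheme \<Rightarrow> ('k, 'v, 'e1) module_scheme \<Rightarrow> ('k, 'w, 'e2) module_scheme
     \<Rightarrow> ('k, 'v2, 'e3) module_scheme \<Rightarrow> ('k, 'w2, 'e4) module_scheme
     \<Rightarrow> ('v \<Rightarrow> 'v2) \<Rightarrow> ('w \<Rightarrow> 'w2) \<Rightarrow> ('v \<times> 'w \<Rightarrow> 'k) set \<Rightarrow> ('v2 \<times> 'w2 \<Rightarrow> 'k) set" where
  "tensor_map K V W V' W' f g =
     tensor_lift K V W (tensor K V' W') (\<lambda>v w. pure_tensor K V' W' (f v) (g w))"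

definition tensor_flip ::
  "('k, 'r) ring_scheme \<Rightarrow> ('k, 'v, 'e1) module_scheme \<Rightarrow> ('k, 'w, 'e2) module_scheme
     \<Rightarrow> ('v \<times> 'w \<Rightarrow> 'k) set \<Rightarrow> ('w \<times> 'v \<Rightarrow> 'k) set" where
  "tensor_flip K V W =
     tensor_lift K V W (tensor K W V) (\<lambda>v w. pure_tensor K W V w v)"

text \<open>Threefold tensor products are nested to the right. The associator
  $(U \otimes V) \otimes W \to U \otimes (V \otimes W)$ sends
  $(u \otimes v) \otimes w$ to $u \otimes (v \otimes w)$, and \<open>tensor_flip12\<close> is the map
  $u \otimes (v \otimes w) \mapsto v \otimes (u \otimes w)$.\<close>

definition tensor_assoc ::
  "('k, 'r) ring_scheme \<Rightarrow> ('k, 'u, 'e1) module_scheme \<Rightarrow> ('k, 'v, 'e2) module_scheme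
     \<Rightarrow> ('k, 'w, 'e3) module_scheme
     \<Rightarrow> (('u \<times> 'v \<Rightarrow> 'k) set \<times> 'w \<Rightarrow> 'k) set \<Rightarrow> ('u \<times> ('v \<times> 'w \<Rightarrow> 'k) set \<Rightarrow> 'k) set" where
  "tensor_assoc K U V W =
     tensor_lift K (tensor K U V) W (tensor K U (tensor K V W))
       (\<lambda>t w. tensor_lift K U V (tensor K U (tensor K V W))
          (\<lambda>u v. pure_tensor K U (tensor K V W) u (pure_tensor K V W v w)) t)"

definition tensor_flip12 ::
  "('k, 'r) ring_scheme \<Rightarrow> ('k, 'u, 'e1) module_scheme \<Rightarrow> ('k, 'v, 'e2) module_scheme
     \<Rightarrow> ('k, 'w, 'e3) module_scheme
     \<Rightarrow> ('u \<times> ('v \<times> 'w \<Rightarrow> 'k) set \<Rightarrow> 'k) set \<Rightarrow> ('v \<times> ('u \<times> 'w \<Rightarrow> 'k) set \<Rightarrow> 'k) set" where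
  "tensor_flip12 K U V W =
     tensor_lift K U (tensor K V W) (tensor K V (tensor K U W))
       (\<lambda>u t. tensor_lift K V W (tensor K V (tensor K U W))
          (\<lambda>v w. pure_tensor K V (tensor K U W) v (pure_tensor K U W u w)) t)"

lemma submodule_abelian_subgroup:
  assumes "submodule K N M"
  shows "abelian_subgroup N M"
proof -
  interpret S: submodule K N M by fact
  interpret M: module K M by (rule S.module)
  have "subgroup N (add_monoid M)"
  proof
    show "N \<subseteq> carrier (add_monoid M)" using S.subset by simp
    show "x \<otimes>\<^bsub>add_monoid M\<^esub> y \<in> N" if "x \<in> N" "y \<in> N" for x y
      using that by simp
    show "\<one>\<^bsub>add_monoid M\<^esub> \<in> N" by simp
    show "inv\<^bsub>add_monoid M\<^esub> x \<in> N" if "x \<in> N" for x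
    proof -
      have "(\<ominus>\<^bsub>K\<^esub> \<one>\<^bsub>K\<^esub>) \<odot>\<^bsub>M\<^esub> x \<in> N" using that by simp
      moreover have "x \<in> carrier M" using that S.subset by auto
      ultimately have "\<ominus>\<^bsub>M\<^esub> x \<in> N" by (simp only: M.smult_minus_1)
      then show ?thesis by (simp add: a_inv_def)
    qed
  qed
  then show ?thesis
    by (intro abelian_subgroupI3 additive_subgroupI M.abelian_group_axioms)
qed

lemma quotient_module_smult:
  assumes "submodule K N M" "c \<in> carrier K" "x \<in> carrier M"
  shows "c \<odot>\<^bsub>quotient_module M N\<^esub> (N +>\<^bsub>M\<^esub> x) = N +>\<^bsub>M\<^esub> (c \<odot>\<^bsub>M\<^esub> x)"
proof -
  interpret S: submodule K N M by fact
  interpret M: module K M by (rule S.module)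
  interpret A: abelian_subgroup N M by (rule submodule_abelian_subgroup) fact
  have "N +>\<^bsub>M\<^esub> (c \<odot>\<^bsub>M\<^esub> y) = N +>\<^bsub>M\<^esub> (c \<odot>\<^bsub>M\<^esub> x)" if y: "y \<in> N +>\<^bsub>M\<^esub> x" for y
  proof -
    obtain n where n: "n \<in> N" "y = n \<oplus>\<^bsub>M\<^esub> x"
      using y by (auto simp: a_r_coset_def')
    have "n \<in> carrier M" using n S.subset by auto
    then have "c \<odot>\<^bsub>M\<^esub> y = c \<odot>\<^bsub>M\<^esub> n \<oplus>\<^bsub>M\<^esub> c \<odot>\<^bsub>M\<^esub> x"
      using assms n by (simp add: M.smult_r_distr)
    moreover have "c \<odot>\<^bsub>M\<^esub> n \<in> N" using n assms by simp
    ultimately have "c \<odot>\<^bsub>M\<^esub> y \<in> N +>\<^bsub>M\<^esub> (c \<odot>\<^bsub>M\<^esub> x)"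
      by (auto simp: a_r_coset_def')
    then show ?thesis
      using M.a_repr_independence[OF _ _ A.a_subgroup] assms by auto
  qed
  then have "(\<Union>y\<in>N +>\<^bsub>M\<^esub> x. N +>\<^bsub>M\<^esub> (c \<odot>\<^bsub>M\<^esub> y))
      = (\<Union>y\<in>N +>\<^bsub>M\<^esub> x. N +>\<^bsub>M\<^esub> (c \<odot>\<^bsub>M\<^esub> x))"
    by (intro SUP_cong refl)
  moreover have "x \<in> N +>\<^bsub>M\<^esub> x" using A.a_rcos_self assms by auto
  ultimately show ?thesis by (auto simp: quotient_module_def)
qed

lemma quotient_module_module:
  assumes "submodule K N M"
  shows "module K (quotient_module M N)"
proof -
  interpret S: submodule K N M by fact
  interpret M: module K M by (rule S.module)
  interpret A: abelian_subgroup N M by (rule submodule_abelian_subgroup) fact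
  let ?Q = "quotient_module M N"
  have car: "carrier ?Q = (\<lambda>x. N +>\<^bsub>M\<^esub> x) ` carrier M"
    by (auto simp: quotient_module_def A_RCOSETS_def')
  have add: "(N +>\<^bsub>M\<^esub> x) \<oplus>\<^bsub>?Q\<^esub> (N +>\<^bsub>M\<^esub> y) = N +>\<^bsub>M\<^esub> (x \<oplus>\<^bsub>M\<^esub> y)"
    if "x \<in> carrier M" "y \<in> carrier M" for x y
    using that by (simp add: quotient_module_def A.a_rcos_sum)
  have zero: "\<zero>\<^bsub>?Q\<^esub> = N +>\<^bsub>M\<^esub> \<zero>\<^bsub>M\<^esub>"
    using S.subset by (simp add: quotient_module_def)
  note sm = quotient_module_smult[OF assms]
  show ?thesis
  proof (rule module_criteria)
    show "cring K" ..
    show "\<zero>\<^bsub>?Q\<^esub> \<in> carrier ?Q" by (auto simp: car zero)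
    show "\<forall>v\<in>carrier ?Q. \<exists>n\<in>carrier ?Q. v \<oplus>\<^bsub>?Q\<^esub> n = \<zero>\<^bsub>?Q\<^esub>"
    proof
      fix v assume "v \<in> carrier ?Q"
      then obtain x where "x \<in> carrier M" "v = N +>\<^bsub>M\<^esub> x" by (auto simp: car)
      then show "\<exists>n\<in>carrier ?Q. v \<oplus>\<^bsub>?Q\<^esub> n = \<zero>\<^bsub>?Q\<^esub>"
        by (intro bexI[of _ "N +>\<^bsub>M\<^esub> (\<ominus>\<^bsub>M\<^esub> x)"]) (auto simp: add zero car M.r_neg)
    qed
  qed (auto simp: car add zero sm M.a_ac M.smult_assoc1 M.smult_l_distr M.smult_r_distr)
qed

lemma free_module_simps:
  assumes "ring K"
  shows "carrier (free_module K S) = {f \<in> S \<rightarrow>\<^sub>E carrier K. finite {s \<in> S. f s \<noteq> \<zero>\<^bsub>K\<^esub>}}"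
    and "f \<oplus>\<^bsub>free_module K S\<^esub> g = (\<lambda>s\<in>S. f s \<oplus>\<^bsub>K\<^esub> g s)"
    and "c \<odot>\<^bsub>free_module K S\<^esub> f = (\<lambda>s\<in>S. c \<otimes>\<^bsub>K\<^esub> f s)"
    and "\<zero>\<^bsub>free_module K S\<^esub> = (\<lambda>s\<in>S. \<zero>\<^bsub>K\<^esub>)"
  using assms by (simp_all add: free_module_def ring.func_space_def)

lemma free_module_module:
  assumes "cring K"
  shows "module K (free_module K S)"
proof -
  interpret K: cring K by fact
  interpret F: module K "K.func_space S" by (rule K.func_space_is_module)
  have "submodule K {f \<in> S \<rightarrow>\<^sub>E carrier K. finite {s \<in> S. f s \<noteq> \<zero>\<^bsub>K\<^esub>}} (K.func_space S)"
  proof (unfold_locales, goal_cases)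
    case 1 then show ?case by (auto simp: K.func_space_def)
  next
    case (2 v w)
    have "{s \<in> S. v s \<oplus>\<^bsub>K\<^esub> w s \<noteq> \<zero>\<^bsub>K\<^esub>}
            \<subseteq> {s \<in> S. v s \<noteq> \<zero>\<^bsub>K\<^esub>} \<union> {s \<in> S. w s \<noteq> \<zero>\<^bsub>K\<^esub>}" by auto
    then have "finite {s \<in> S. v s \<oplus>\<^bsub>K\<^esub> w s \<noteq> \<zero>\<^bsub>K\<^esub>}"
      using 2 by (auto intro: finite_subset)
    then show ?case using 2
      by (auto simp: K.func_space_def Pi_iff PiE_iff cong: conj_cong)
  next
    case 3 then show ?case by (auto simp: K.func_space_def cong: conj_cong)
  next
    case (4 c v)
    have "{s \<in> S. c \<otimes>\<^bsub>K\<^esub> v s \<noteq> \<zero>\<^bsub>K\<^esub>} \<subseteq> {s \<in> S. v s \<noteq> \<zero>\<^bsub>K\<^esub>}" using 4 by auto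
    then have "finite {s \<in> S. c \<otimes>\<^bsub>K\<^esub> v s \<noteq> \<zero>\<^bsub>K\<^esub>}"
      using 4 by (auto intro: finite_subset)
    then show ?case using 4
      by (auto simp: K.func_space_def PiE_iff cong: conj_cong)
  qed
  then show ?thesis unfolding free_module_def by (rule F.submodule_is_module)
qed

lemma free_gen_closed:
  assumes "cring K" "s \<in> S"
  shows "free_gen K S s \<in> carrier (free_module K S)"
proof -
  interpret K: cring K by fact
  have "{t \<in> S. free_gen K S s t \<noteq> \<zero>\<^bsub>K\<^esub>} \<subseteq> {s}" by (auto simp: free_gen_def)
  then have "finite {t \<in> S. free_gen K S s t \<noteq> \<zero>\<^bsub>K\<^esub>}" by (auto intro: finite_subset)
  moreover have "free_gen K S s \<in> S \<rightarrow>\<^sub>E carrier K" by (auto simp: free_gen_def)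
  ultimately show ?thesis by (simp add: free_module_simps[OF K.ring_axioms])
qed

lemma free_module_induct [consumes 2, case_names zero add]:
  assumes "cring K" and f: "f \<in> carrier (free_module K S)"
    and zero: "P \<zero>\<^bsub>free_module K S\<^esub>"
    and add: "\<And>c s g. c \<in> carrier K \<Longrightarrow> s \<in> S \<Longrightarrow> g \<in> carrier (free_module K S) \<Longrightarrow> P g \<Longrightarrow>
       P (c \<odot>\<^bsub>free_module K S\<^esub> free_gen K S s \<oplus>\<^bsub>free_module K S\<^esub> g)"
  shows "P f"
proof -
  interpret K: cring K by fact
  note fm = free_module_simps[OF K.ring_axioms]
  have "finite {s \<in> S. f s \<noteq> \<zero>\<^bsub>K\<^esub>}" using f by (simp add: fm)
  then show ?thesis using f
  proof (induction "{s \<in> S. f s \<noteq> \<zero>\<^bsub>K\<^esub>}" arbitrary: f rule: finite_induct)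
    case empty
    then have "f = \<zero>\<^bsub>free_module K S\<^esub>"
      by (auto simp: fm PiE_iff extensional_def fun_eq_iff)
    then show ?case using zero by simp
  next
    case (insert s A)
    define g where "g = (\<lambda>t\<in>S. if t = s then \<zero>\<^bsub>K\<^esub> else f t)"
    have s: "s \<in> S" using insert.hyps(4) by auto
    have fin: "finite {s \<in> S. f s \<noteq> \<zero>\<^bsub>K\<^esub>}" using insert.prems by (simp add: fm)
    have A: "A = {t \<in> S. g t \<noteq> \<zero>\<^bsub>K\<^esub>}"
    proof -
      have "A = {t \<in> S. f t \<noteq> \<zero>\<^bsub>K\<^esub>} - {s}" using insert.hyps(2,4) by auto
      then show ?thesis by (auto simp: g_def split: if_splits)
    qed
    have fc: "f \<in> S \<rightarrow>\<^sub>E carrier K" using insert.prems by (simp add: fm)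
    have g: "g \<in> carrier (free_module K S)"
      using fc insert.hyps(1) unfolding A by (auto simp: fm g_def PiE_iff)
    have "f = f s \<odot>\<^bsub>free_module K S\<^esub> free_gen K S s \<oplus>\<^bsub>free_module K S\<^esub> g"
      using fc s by (auto simp: fm free_gen_def g_def fun_eq_iff PiE_iff extensional_def)
    moreover have "P (f s \<odot>\<^bsub>free_module K S\<^esub> free_gen K S s \<oplus>\<^bsub>free_module K S\<^esub> g)"
      using fc s g by (intro add insert.hyps(3) A) auto
    ultimately show ?case by simp
  qed
qed

lemma free_module_ext:
  assumes "module K P" and h: "\<And>s. s \<in> S \<Longrightarrow> h s \<in> carrier P"
  shows "\<exists>T \<in> module_hom K (free_module K S) P. \<forall>s\<in>S. T (free_gen K S s) = h s"
proof -
  interpret P: module K P by fact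
  note fm = free_module_simps[OF P.R.ring_axioms]
  let ?F = "free_module K S"
  define T where "T f = (\<Oplus>\<^bsub>P\<^esub>s\<in>{s \<in> S. f s \<noteq> \<zero>\<^bsub>K\<^esub>}. f s \<odot>\<^bsub>P\<^esub> h s)" for f
  have T: "T f = (\<Oplus>\<^bsub>P\<^esub>s\<in>A. f s \<odot>\<^bsub>P\<^esub> h s)"
    if "f \<in> carrier ?F" "finite A" "{s \<in> S. f s \<noteq> \<zero>\<^bsub>K\<^esub>} \<subseteq> A" "A \<subseteq> S" for f A
    unfolding T_def using that h
    by (intro P.add.finprod_mono_neutral_cong_left) (auto simp: fm PiE_iff subset_iff)
  have fin: "finite {s \<in> S. f s \<noteq> \<zero>\<^bsub>K\<^esub>}" if "f \<in> carrier ?F" for f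
    using that by (simp add: fm)
  interpret F: module K ?F by (rule free_module_module) (rule P.R.is_cring)
  have fc: "f s \<in> carrier K" if "f \<in> carrier ?F" "s \<in> S" for f s
    using that by (auto simp: fm)
  have "T \<in> module_hom K ?F P"
    unfolding module_hom_def
  proof (intro CollectI conjI allI impI funcsetI; (elim conjE)?)
    fix f assume f: "f \<in> carrier ?F"
    show "T f \<in> carrier P" unfolding T_def using f h by (auto intro!: P.finsum_closed fc)
  next
    fix f g assume f: "f \<in> carrier ?F" and g: "g \<in> carrier ?F"
    let ?A = "{s \<in> S. f s \<noteq> \<zero>\<^bsub>K\<^esub>} \<union> {s \<in> S. g s \<noteq> \<zero>\<^bsub>K\<^esub>}"
    have A: "finite ?A" using fin f g by auto
    have "T (f \<oplus>\<^bsub>?F\<^esub> g) = (\<Oplus>\<^bsub>P\<^esub>s\<in>?A. (f \<oplus>\<^bsub>?F\<^esub> g) s \<odot>\<^bsub>P\<^esub> h s)"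
      by (rule T[OF F.add.m_closed[OF f g] A]) (auto simp: fm(2))
    also have "\<dots> = (\<Oplus>\<^bsub>P\<^esub>s\<in>?A. f s \<odot>\<^bsub>P\<^esub> h s \<oplus>\<^bsub>P\<^esub> g s \<odot>\<^bsub>P\<^esub> h s)"
      using f g h by (intro P.finsum_cong') (auto simp: fm(2) P.smult_l_distr fc)
    also have "\<dots> = (\<Oplus>\<^bsub>P\<^esub>s\<in>?A. f s \<odot>\<^bsub>P\<^esub> h s) \<oplus>\<^bsub>P\<^esub> (\<Oplus>\<^bsub>P\<^esub>s\<in>?A. g s \<odot>\<^bsub>P\<^esub> h s)"
      using f g h by (intro P.finsum_addf) (auto simp: fc)
    also have "\<dots> = T f \<oplus>\<^bsub>P\<^esub> T g"
      by (subst T[OF f A], simp, simp, subst T[OF g A]) auto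
    finally show "T (f \<oplus>\<^bsub>?F\<^esub> g) = T f \<oplus>\<^bsub>P\<^esub> T g" .
  next
    fix c f assume c: "c \<in> carrier K" and f: "f \<in> carrier ?F"
    let ?A = "{s \<in> S. f s \<noteq> \<zero>\<^bsub>K\<^esub>}"
    have "T (c \<odot>\<^bsub>?F\<^esub> f) = (\<Oplus>\<^bsub>P\<^esub>s\<in>?A. (c \<odot>\<^bsub>?F\<^esub> f) s \<odot>\<^bsub>P\<^esub> h s)"
      using f c by (intro T[OF F.smult_closed[OF c f] fin[OF f]]) (auto simp: fm(3))
    also have "\<dots> = (\<Oplus>\<^bsub>P\<^esub>s\<in>?A. c \<odot>\<^bsub>P\<^esub> (f s \<odot>\<^bsub>P\<^esub> h s))"
      using f c h by (intro P.finsum_cong') (auto simp: fm(3) P.smult_assoc1 fc)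
    also have "\<dots> = c \<odot>\<^bsub>P\<^esub> T f"
      unfolding T_def using f c h by (intro P.finsum_smult[symmetric]) (auto simp: fc)
    finally show "T (c \<odot>\<^bsub>?F\<^esub> f) = c \<odot>\<^bsub>P\<^esub> T f" .
  qed
  moreover have "T (free_gen K S s) = h s" if s: "s \<in> S" for s
  proof -
    have "T (free_gen K S s) = (\<Oplus>\<^bsub>P\<^esub>t\<in>{s}. free_gen K S s t \<odot>\<^bsub>P\<^esub> h t)"
      using s free_gen_closed[OF P.R.is_cring s] by (intro T) (auto simp: free_gen_def)
    also have "\<dots> = h s" using s h by (simp add: free_gen_def)
    finally show ?thesis .
  qed
  ultimately show ?thesis by blast
qed

context
  fixes K :: "('k, 'r) ring_scheme" and V :: "('k, 'v, 'e1) module_scheme"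
    and W :: "('k, 'w, 'e2) module_scheme"
  assumes V: "vectorspace K V" and W: "vectorspace K W"
begin

interpretation V: vectorspace K V by (rule V)
interpretation W: vectorspace K W by (rule W)

private abbreviation (input) "F \<equiv> free_module K (carrier V \<times> carrier W)"
private abbreviation (input) "g v w \<equiv> free_gen K (carrier V \<times> carrier W) (v, w)"

interpretation F: module K F by (rule free_module_module) (rule V.R.is_cring)

private lemma gen_closed: "v \<in> carrier V \<Longrightarrow> w \<in> carrier W \<Longrightarrow> g v w \<in> carrier F"
  by (rule free_gen_closed) (auto intro: V.R.is_cring)

lemma tensor_relations_closed: "tensor_relations K V W \<subseteq> carrier F"
  unfolding tensor_relations_def Let_def
  by (auto intro!: F.minus_closed F.add.m_closed F.smult_closed gen_closed)

lemma tensor_null_submodule: "submodule K (tensor_null K V W) F"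
  unfolding tensor_null_def
  by (rule F.span_is_submodule) (rule tensor_relations_closed)

interpretation N: submodule K "tensor_null K V W" F by (rule tensor_null_submodule)
interpretation N: abelian_subgroup "tensor_null K V W" F
  by (rule submodule_abelian_subgroup) (rule tensor_null_submodule)

lemma tensor_vectorspace: "vectorspace K (tensor K V W)"
  unfolding tensor_def vectorspace_def
  using quotient_module_module[OF tensor_null_submodule] V.field_axioms by simp

interpretation T: vectorspace K "tensor K V W" by (rule tensor_vectorspace)

private definition "cls f = tensor_null K V W +>\<^bsub>F\<^esub> f"

private lemma cls_hom: "cls \<in> module_hom K F (tensor K V W)"
  unfolding module_hom_def
  using quotient_module_smult[OF tensor_null_submodule]
  by (auto simp: cls_def tensor_def N.a_rcos_sum quotient_module_def A_RCOSETS_def')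

private lemma cls_surj: "carrier (tensor K V W) = cls ` carrier F"
  by (auto simp: tensor_def quotient_module_def A_RCOSETS_def' cls_def)

private lemma cls_eqI:
  assumes "x \<ominus>\<^bsub>F\<^esub> y \<in> tensor_relations K V W" "x \<in> carrier F" "y \<in> carrier F"
  shows "cls x = cls y"
proof -
  have "x \<ominus>\<^bsub>F\<^esub> y \<in> tensor_null K V W"
    unfolding tensor_null_def using F.in_own_span[OF tensor_relations_closed] assms(1) by auto
  then have "x \<in> tensor_null K V W +>\<^bsub>F\<^esub> y"
    using assms(2,3) by (auto simp: a_r_coset_def' a_minus_def F.add.m_assoc F.l_neg
        intro!: bexI[of _ "x \<ominus>\<^bsub>F\<^esub> y"])
  then show ?thesis
    using F.a_repr_independence[OF _ _ N.a_subgroup] assms by (simp add: cls_def)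
qed

private lemma pure_tensor_cls: "pure_tensor K V W v w = cls (g v w)"
  by (simp add: pure_tensor_def cls_def)

lemma pure_tensor_bilinear: "bilinear_map K V W (tensor K V W) (pure_tensor K V W)"
proof -
  have "\<forall>v\<in>carrier V. \<forall>w\<in>carrier W. pure_tensor K V W v w \<in> carrier (tensor K V W)"
    using gen_closed by (auto simp: pure_tensor_cls cls_surj)
  moreover have "cls (g (v \<oplus>\<^bsub>V\<^esub> v') w) = cls (g v w) \<oplus>\<^bsub>tensor K V W\<^esub> cls (g v' w)"
    if "v \<in> carrier V" "v' \<in> carrier V" "w \<in> carrier W" for v v' w
  proof -
    have "g (v \<oplus>\<^bsub>V\<^esub> v') w \<ominus>\<^bsub>F\<^esub> (g v w \<oplus>\<^bsub>F\<^esub> g v' w) \<in> tensor_relations K V W"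
      unfolding tensor_relations_def Let_def using that by blast
    from cls_eqI[OF this] show ?thesis
      using that gen_closed by (simp add: module_hom_add[OF cls_hom])
  qed
  moreover have "cls (g v (w \<oplus>\<^bsub>W\<^esub> w')) = cls (g v w) \<oplus>\<^bsub>tensor K V W\<^esub> cls (g v w')"
    if "v \<in> carrier V" "w \<in> carrier W" "w' \<in> carrier W" for v w w'
  proof -
    have "g v (w \<oplus>\<^bsub>W\<^esub> w') \<ominus>\<^bsub>F\<^esub> (g v w \<oplus>\<^bsub>F\<^esub> g v w') \<in> tensor_relations K V W"
      unfolding tensor_relations_def Let_def using that by blast
    from cls_eqI[OF this] show ?thesis
      using that gen_closed by (simp add: module_hom_add[OF cls_hom])
  qed
  moreover have "cls (g (c \<odot>\<^bsub>V\<^esub> v) w) = c \<odot>\<^bsub>tensor K V W\<^esub> cls (g v w)"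
    if "c \<in> carrier K" "v \<in> carrier V" "w \<in> carrier W" for c v w
  proof -
    have "g (c \<odot>\<^bsub>V\<^esub> v) w \<ominus>\<^bsub>F\<^esub> (c \<odot>\<^bsub>F\<^esub> g v w) \<in> tensor_relations K V W"
      unfolding tensor_relations_def Let_def using that by blast
    from cls_eqI[OF this] show ?thesis
      using that gen_closed by (simp add: module_hom_smult[OF cls_hom])
  qed
  moreover have "cls (g v (c \<odot>\<^bsub>W\<^esub> w)) = c \<odot>\<^bsub>tensor K V W\<^esub> cls (g v w)"
    if "c \<in> carrier K" "v \<in> carrier V" "w \<in> carrier W" for c v w
  proof -
    have "g v (c \<odot>\<^bsub>W\<^esub> w) \<ominus>\<^bsub>F\<^esub> (c \<odot>\<^bsub>F\<^esub> g v w) \<in> tensor_relations K V W"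
      unfolding tensor_relations_def Let_def using that by blast
    from cls_eqI[OF this] show ?thesis
      using that gen_closed by (simp add: module_hom_smult[OF cls_hom])
  qed
  ultimately show ?thesis
    unfolding bilinear_map_def module_hom_def by (auto simp: pure_tensor_cls)
qed

lemma tensor_induct [consumes 1, case_names zero add]:
  assumes "t \<in> carrier (tensor K V W)" and "P \<zero>\<^bsub>tensor K V W\<^esub>"
    and add: "\<And>v w u. v \<in> carrier V \<Longrightarrow> w \<in> carrier W \<Longrightarrow> u \<in> carrier (tensor K V W) \<Longrightarrow> P u \<Longrightarrow>
       P (pure_tensor K V W v w \<oplus>\<^bsub>tensor K V W\<^esub> u)"
  shows "P t"
proof -
  interpret c: mod_hom K F "tensor K V W" cls
    by unfold_locales (rule cls_hom)
  have "P (cls f)" if "f \<in> carrier F" for f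
    using V.R.is_cring that
  proof (induction rule: free_module_induct)
    case zero then show ?case using assms(2) c.f0_is_0 by simp
  next
    case (add a s h)
    then obtain v w where s: "s = (v, w)" "v \<in> carrier V" "w \<in> carrier W" by auto
    have "cls (a \<odot>\<^bsub>F\<^esub> free_gen K (carrier V \<times> carrier W) s \<oplus>\<^bsub>F\<^esub> h)
        = a \<odot>\<^bsub>tensor K V W\<^esub> cls (g v w) \<oplus>\<^bsub>tensor K V W\<^esub> cls h"
      using add s gen_closed by simp
    also have "a \<odot>\<^bsub>tensor K V W\<^esub> cls (g v w) = pure_tensor K V W (a \<odot>\<^bsub>V\<^esub> v) w"
      using pure_tensor_bilinear add s
      by (auto simp: bilinear_map_def module_hom_def pure_tensor_cls)
    finally show ?case using add s by (auto intro!: assms(3) simp: cls_surj)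
  qed
  then show ?thesis using assms(1) by (auto simp: cls_surj)
qed

text \<open>The universal property of the tensor product.\<close>

lemma tensor_lift_ex1:
  assumes P: "vectorspace K P" and b: "bilinear_map K V W P b"
  shows "\<exists>!T. T \<in> module_hom K (tensor K V W) P \<and>
     T \<in> extensional (carrier (tensor K V W)) \<and>
     (\<forall>v\<in>carrier V. \<forall>w\<in>carrier W. T (pure_tensor K V W v w) = b v w)"
proof -
  interpret P: vectorspace K P by (rule P)
  have bc: "b v w \<in> carrier P" if "v \<in> carrier V" "w \<in> carrier W" for v w
    using that b by (auto simp: bilinear_map_def module_hom_def)
  obtain L where L: "L \<in> module_hom K F P"
    and Lg: "\<And>v w. v \<in> carrier V \<Longrightarrow> w \<in> carrier W \<Longrightarrow> L (g v w) = b v w"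
    using free_module_ext[OF P.module_axioms, of "carrier V \<times> carrier W" "\<lambda>(v, w). b v w"] bc
    by fastforce
  interpret L: mod_hom K F P L by unfold_locales (rule L)
  have Lminus: "L (x \<ominus>\<^bsub>F\<^esub> y) = \<zero>\<^bsub>P\<^esub>"
    if "x \<in> carrier F" "y \<in> carrier F" "L x = L y" for x y
  proof -
    have "L (x \<ominus>\<^bsub>F\<^esub> y) \<oplus>\<^bsub>P\<^esub> L y = L (x \<ominus>\<^bsub>F\<^esub> y \<oplus>\<^bsub>F\<^esub> y)"
      using that by (subst L.f_add) auto
    also have "x \<ominus>\<^bsub>F\<^esub> y \<oplus>\<^bsub>F\<^esub> y = x"
      using that by (simp add: a_minus_def F.add.m_assoc F.l_neg)
    finally have "L (x \<ominus>\<^bsub>F\<^esub> y) \<oplus>\<^bsub>P\<^esub> L y = \<zero>\<^bsub>P\<^esub> \<oplus>\<^bsub>P\<^esub> L y"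
      using that by simp
    then show ?thesis
      using that by (subst (asm) P.add.right_cancel) auto
  qed
  have kerI: "x \<ominus>\<^bsub>F\<^esub> y \<in> L.ker" if "x \<in> carrier F" "y \<in> carrier F" "L x = L y" for x y
    using Lminus[OF that] that by (simp add: L.ker_def)
  have b_hom: "v \<in> carrier V \<Longrightarrow> b v \<in> module_hom K W P"
      "w \<in> carrier W \<Longrightarrow> (\<lambda>v. b v w) \<in> module_hom K V P" for v w
    using b by (auto simp: bilinear_map_def)
  have r1: "g (v \<oplus>\<^bsub>V\<^esub> v') w \<ominus>\<^bsub>F\<^esub> (g v w \<oplus>\<^bsub>F\<^esub> g v' w) \<in> L.ker"
    if "v \<in> carrier V" "v' \<in> carrier V" "w \<in> carrier W" for v v' w
    using that module_hom_add[OF b_hom(2)] by (intro kerI) (simp_all add: gen_closed Lg)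
  have r2: "g v (w \<oplus>\<^bsub>W\<^esub> w') \<ominus>\<^bsub>F\<^esub> (g v w \<oplus>\<^bsub>F\<^esub> g v w') \<in> L.ker"
    if "v \<in> carrier V" "w \<in> carrier W" "w' \<in> carrier W" for v w w'
    using that module_hom_add[OF b_hom(1)] by (intro kerI) (simp_all add: gen_closed Lg)
  have r3: "g (c \<odot>\<^bsub>V\<^esub> v) w \<ominus>\<^bsub>F\<^esub> (c \<odot>\<^bsub>F\<^esub> g v w) \<in> L.ker"
    if "c \<in> carrier K" "v \<in> carrier V" "w \<in> carrier W" for c v w
    using that module_hom_smult[OF b_hom(2)] by (intro kerI) (simp_all add: gen_closed Lg)
  have r4: "g v (c \<odot>\<^bsub>W\<^esub> w) \<ominus>\<^bsub>F\<^esub> (c \<odot>\<^bsub>F\<^esub> g v w) \<in> L.ker"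
    if "c \<in> carrier K" "v \<in> carrier V" "w \<in> carrier W" for c v w
    using that module_hom_smult[OF b_hom(1)] by (intro kerI) (simp_all add: gen_closed Lg)
  have "tensor_relations K V W \<subseteq> L.ker"
    unfolding tensor_relations_def Let_def
    by (intro Un_least subsetI; elim CollectE exE conjE; hypsubst) (simp_all only: r1 r2 r3 r4)
  then have "tensor_null K V W \<subseteq> L.ker"
    unfolding tensor_null_def by (rule F.span_is_subset) (rule L.ker_is_submodule)
  then have null: "L n = \<zero>\<^bsub>P\<^esub>" if "n \<in> tensor_null K V W" for n
    using that by (auto simp: L.ker_def)
  have well: "L f = L f'" if "cls f = cls f'" "f \<in> carrier F" "f' \<in> carrier F" for f f'
  proof -
    have "f \<in> cls f'" using that N.a_rcos_self by (metis cls_def)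
    then obtain n where n: "n \<in> tensor_null K V W" "f = n \<oplus>\<^bsub>F\<^esub> f'"
      by (auto simp: cls_def a_r_coset_def')
    then show ?thesis using that null N.a_subset by auto
  qed
  define T where "T = (\<lambda>t\<in>carrier (tensor K V W). L (SOME f. f \<in> carrier F \<and> cls f = t))"
  have T: "T (cls f) = L f" if f: "f \<in> carrier F" for f
  proof -
    have "(SOME f'. f' \<in> carrier F \<and> cls f' = cls f) \<in> carrier F \<and>
        cls (SOME f'. f' \<in> carrier F \<and> cls f' = cls f) = cls f"
      using f by (intro someI_ex[of "\<lambda>f'. f' \<in> carrier F \<and> cls f' = cls f"]) auto
    then show ?thesis using f by (auto simp: T_def cls_surj intro!: well)
  qed
  have add: "cls f \<oplus>\<^bsub>tensor K V W\<^esub> cls f' = cls (f \<oplus>\<^bsub>F\<^esub> f')"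
    if "f \<in> carrier F" "f' \<in> carrier F" for f f'
    using module_hom_add[OF cls_hom] that by simp
  have sm: "c \<odot>\<^bsub>tensor K V W\<^esub> cls f = cls (c \<odot>\<^bsub>F\<^esub> f)"
    if "f \<in> carrier F" "c \<in> carrier K" for c f
    using module_hom_smult[OF cls_hom] that by simp
  have Thom: "T \<in> module_hom K (tensor K V W) P"
    unfolding module_hom_def by (auto simp: cls_surj T add sm)
  have Tpure: "T (pure_tensor K V W v w) = b v w"
    if "v \<in> carrier V" "w \<in> carrier W" for v w
    using that gen_closed by (simp add: pure_tensor_cls T Lg)
  show ?thesis
  proof (rule ex1I[of _ T], goal_cases)
    case 1 show ?case using Thom Tpure by (auto simp: T_def)
  next
    case (2 T')
    interpret T1: mod_hom K "tensor K V W" P T by unfold_locales (rule Thom)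
    interpret T2: mod_hom K "tensor K V W" P T' by unfold_locales (use 2 in simp)
    have pc: "pure_tensor K V W v w \<in> carrier (tensor K V W)"
      if "v \<in> carrier V" "w \<in> carrier W" for v w
      using that gen_closed by (simp add: pure_tensor_cls cls_surj)
    have "T' t = T t" if "t \<in> carrier (tensor K V W)" for t
      using that
    proof (induction rule: tensor_induct)
      case zero then show ?case by simp
    next
      case (add v w u) then show ?case using pc Tpure 2 by simp
    qed
    then show ?case using 2 by (auto simp: T_def extensional_def fun_eq_iff)
  qed
qed

lemma tensor_lift:
  assumes "vectorspace K P" and "bilinear_map K V W P b"
  shows "tensor_lift K V W P b \<in> module_hom K (tensor K V W) P"
    and "v \<in> carrier V \<Longrightarrow> w \<in> carrier W \<Longrightarrow>
      tensor_lift K V W P b (pure_tensor K V W v w) = b v w"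
  using theI'[OF tensor_lift_ex1[OF assms]] unfolding tensor_lift_def by auto

end

section \<open>Lie coalgebras\<close>

text \<open>In the co-Jacobi identity, $(I \otimes \delta)\delta$ lands in $L \otimes (L \otimes L)$
  and $(\delta \otimes I)\delta$ in $(L \otimes L) \otimes L$; they are compared through the
  associator.\<close>

locale lie_coalgebra = linear_map K L "tensor K L L" \<delta>
  for K and L and \<delta> +
  assumes co_antisym: "x \<in> carrier L \<Longrightarrow>
      \<delta> x = \<ominus>\<^bsub>tensor K L L\<^esub> tensor_flip K L L (\<delta> x)"
    and co_jacobi: "x \<in> carrier L \<Longrightarrow>
      tensor_map K L L L (tensor K L L) (\<lambda>y. y) \<delta> (\<delta> x)
        \<ominus>\<^bsub>tensor K L (tensor K L L)\<^esub>
          tensor_flip12 K L L L (tensor_map K L L L (tensor K L L) (\<lambda>y. y) \<delta> (\<delta> x))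
      = tensor_assoc K L L L (tensor_map K L L (tensor K L L) L \<delta> (\<lambda>y. y) (\<delta> x))"

locale lie_coalgebra_hom =
  dom: lie_coalgebra K L \<delta> + cod: lie_coalgebra K M \<epsilon> + linear_map K L M \<phi>
  for K and L and \<delta> and M and \<epsilon> and \<phi> +
  assumes hom_cobracket: "x \<in> carrier L \<Longrightarrow> \<epsilon> (\<phi> x) = tensor_map K L L M M \<phi> \<phi> (\<delta> x)"

locale lie_coalgebra_iso = lie_coalgebra_hom +
  assumes bij: "bij_betw \<phi> (carrier L) (carrier M)"

text \<open>\<open>\<gamma>\<close> is a cobracket on the subspace \<open>G\<close> of \<open>E\<close>. The equation
  $\delta_E|_G = \gamma$ is read via the map $G \otimes G \to E \otimes E$ induced by the
  inclusion.\<close>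

locale lie_subcoalgebra =
  sub: lie_coalgebra K "E\<lparr>carrier := G\<rparr>" \<gamma> + amb: lie_coalgebra K E \<delta> + subspace K G E
  for K and G and \<gamma> and E and \<delta> +
  assumes restrict_cobracket: "a \<in> G \<Longrightarrow>
    \<delta> a = tensor_map K (E\<lparr>carrier := G\<rparr>) (E\<lparr>carrier := G\<rparr>) E E (\<lambda>y. y) (\<lambda>y. y) (\<gamma> a)"

definition complement ::
  "('k, 'r) ring_scheme \<Rightarrow> 'e set \<Rightarrow> 'e set \<Rightarrow> ('k, 'e, 'm) module_scheme \<Rightarrow> bool" where
  "complement K G V E \<longleftrightarrow> subspace K G E \<and> subspace K V E \<and>
     module.submodule_sum E G V = carrier E \<and> G \<inter> V = {\<zero>\<^bsub>E\<^esub>}"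

section \<open>Unified co-products\<close>

locale extending_datum =
  \<Delta>E: linear_map K V "tensor K G V" \<Delta>\<^sub>E +
  \<Delta>V: linear_map K V "tensor K G G" \<Delta>\<^sub>V +
  \<delta>V: linear_map K V "tensor K V V" \<delta>\<^sub>V
  for K and G and V and \<Delta>\<^sub>E and \<Delta>\<^sub>V and \<delta>\<^sub>V

text \<open>$G \otimes G$, $G \otimes V$, $V \otimes G$ and $V \otimes V$ are mapped into
  $(G \oplus V) \otimes (G \oplus V)$ by the tensor products of the injections.\<close>

definition unified_cobracket ::
  "('k, 'r) ring_scheme \<Rightarrow> ('k, 'g) module \<Rightarrow> ('g \<Rightarrow> ('g \<times> 'g \<Rightarrow> 'k) set) \<Rightarrow> ('k, 'v) module
     \<Rightarrow> ('v \<Rightarrow> ('g \<times> 'v \<Rightarrow> 'k) set) \<Rightarrow> ('v \<Rightarrow> ('g \<times> 'g \<Rightarrow> 'k) set)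
     \<Rightarrow> ('v \<Rightarrow> ('v \<times> 'v \<Rightarrow> 'k) set)
     \<Rightarrow> 'g \<times> 'v \<Rightarrow> (('g \<times> 'v) \<times> ('g \<times> 'v) \<Rightarrow> 'k) set" where
  "unified_cobracket K G \<gamma> V \<Delta>\<^sub>E \<Delta>\<^sub>V \<delta>\<^sub>V =
    (\<lambda>(a, x).
       let S = direct_sum G V; T = tensor K S S; i = inj1 G V; j = inj2 G V
       in
          tensor_map K G G S S i i (\<gamma> a)
          \<oplus>\<^bsub>T\<^esub> tensor_map K G V S S i j (\<Delta>\<^sub>E x)
          \<ominus>\<^bsub>T\<^esub> tensor_map K V G S S j i (tensor_flip K G V (\<Delta>\<^sub>E x))
          \<oplus>\<^bsub>T\<^esub> tensor_map K G G S S i i (\<Delta>\<^sub>V x)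
          \<oplus>\<^bsub>T\<^esub> tensor_map K V V S S j j (\<delta>\<^sub>V x))"

locale lie_coalgebraic_extending_structure =
  lie_coalgebra K G \<gamma> +
  extending_datum K G V \<Delta>\<^sub>E \<Delta>\<^sub>V \<delta>\<^sub>V +
  unified: lie_coalgebra K "direct_sum G V" "unified_cobracket K G \<gamma> V \<Delta>\<^sub>E \<Delta>\<^sub>V \<delta>\<^sub>V"
  for K :: "('k, 'r) ring_scheme" and G :: "('k, 'g) module" and \<gamma>
    and V :: "('k, 'v) module" and \<Delta>\<^sub>E and \<Delta>\<^sub>V and \<delta>\<^sub>V

end

theory Submission
  imports Defs
begin

text \<open>Let $p : E \to G$ and $q : E \to V$ be the projections of $E = G \oplus V$, and take
  $\Delta_E = (p \otimes q)\delta_E$, $\Delta_V = (p \otimes p)\delta_E$ and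
  $\delta_V = (q \otimes q)\delta_E$ on $V$. Since $\varphi = (p, q)$ is $ip + jq$ for the injections
  $i, j$, the map $\varphi \otimes \varphi$ splits into four summands, and antisymmetry of
  $\delta_E$ turns $(jq \otimes ip)\delta_E$ into $-(j \otimes i)\tau\Delta_E$ on $V$. Hence the
  unified cobracket is $\delta_E$ transported along $\varphi$, and so inherits the axioms of a Lie
  coalgebra.\<close>

section \<open>Linear and bilinear maps\<close>

lemma module_hom_compose:
  assumes "f \<in> module_hom K U V" "g \<in> module_hom K V W"
  shows "(\<lambda>x. g (f x)) \<in> module_hom K U W"
  using assms by (auto simp: module_hom_def Pi_iff)

lemma module_hom_pointwise_add:
  assumes "module K W" and f: "f \<in> module_hom K V W" and g: "g \<in> module_hom K V W"
  shows "(\<lambda>x. f x \<oplus>\<^bsub>W\<^esub> g x) \<in> module_hom K V W"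
proof -
  interpret W: module K W by fact
  have "f x \<in> carrier W" "g x \<in> carrier W" if "x \<in> carrier V" for x
    using that f g by (auto simp: module_hom_def)
  then show ?thesis
    using f g by (auto simp: module_hom_def W.a_ac W.smult_r_distr)
qed

text \<open>Commutativity of K moves the fixed scalar \<open>c\<close> past the scalar in the
  homogeneity equation.\<close>

lemma module_hom_pointwise_smult:
  assumes "module K W" and c: "c \<in> carrier K" and f: "f \<in> module_hom K V W"
  shows "(\<lambda>x. c \<odot>\<^bsub>W\<^esub> f x) \<in> module_hom K V W"
proof -
  interpret W: module K W by fact
  have "f x \<in> carrier W" if "x \<in> carrier V" for x
    using that f by (auto simp: module_hom_def)
  then show ?thesis
    using f c by (auto simp: module_hom_def W.smult_r_distr W.R.m_comm simp flip: W.smult_assoc1)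
qed

text \<open>\<open>f\<close> carries the sum, or a multiple, of preimages to that of the given
  vectors, and injectivity of \<open>f\<close> lets the inverse recover it.\<close>

lemma module_hom_inv_into:
  assumes "module K V" and f: "f \<in> module_hom K V W"
    and bij: "bij_betw f (carrier V) (carrier W)"
  shows "inv_into (carrier V) f \<in> module_hom K W V"
proof -
  interpret V: module K V by fact
  let ?h = "inv_into (carrier V) f"
  have hc: "?h w \<in> carrier V" and fh: "f (?h w) = w" if "w \<in> carrier W" for w
    using that bij by (auto simp: bij_betw_def inv_into_into f_inv_into_f)
  have eq: "?h (f v) = v" if "v \<in> carrier V" for v
    using that bij by (auto simp: bij_betw_def)
  have "?h (w \<oplus>\<^bsub>W\<^esub> w') = ?h w \<oplus>\<^bsub>V\<^esub> ?h w'" if "w \<in> carrier W" "w' \<in> carrier W" for w w'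
    using eq[of "?h w \<oplus>\<^bsub>V\<^esub> ?h w'"] that by (simp add: module_hom_add[OF f] hc fh)
  moreover have "?h (c \<odot>\<^bsub>W\<^esub> w) = c \<odot>\<^bsub>V\<^esub> ?h w" if "c \<in> carrier K" "w \<in> carrier W" for c w
    using eq[of "c \<odot>\<^bsub>V\<^esub> ?h w"] that by (simp add: module_hom_smult[OF f] hc fh)
  ultimately show ?thesis
    using hc by (auto simp: module_hom_def)
qed

lemma linear_mapI:
  assumes "vectorspace K V" "vectorspace K W" "f \<in> module_hom K V W"
  shows "linear_map K V W f"
  using assms
  by (auto simp: linear_map_def mod_hom_def mod_hom_axioms_def vectorspace_def)

lemma bilinear_map_homD:
  assumes "bilinear_map K V W P b"
  shows "v \<in> carrier V \<Longrightarrow> b v \<in> module_hom K W P"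
    and "w \<in> carrier W \<Longrightarrow> (\<lambda>v. b v w) \<in> module_hom K V P"
  using assms by (auto simp: bilinear_map_def)

text \<open>Used for the flip, and for lifts whose parameter is the second argument, as in the
  associator.\<close>

lemma bilinear_map_swap:
  "bilinear_map K V W P b \<Longrightarrow> bilinear_map K W V P (\<lambda>w v. b v w)"
  by (auto simp: bilinear_map_def)

text \<open>Supplies bilinearity for \<open>tensor_map\<close> and, with one of the two maps the
  identity, for the inner lifts of \<open>tensor_flip12\<close> and
  \<open>tensor_assoc\<close>.\<close>

lemma bilinear_map_precompose:
  assumes "bilinear_map K V' W' P b" "f \<in> module_hom K V V'" "g \<in> module_hom K W W'"
  shows "bilinear_map K V W P (\<lambda>v w. b (f v) (g w))"
  unfolding bilinear_map_def
proof (intro conjI ballI)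
  fix v assume "v \<in> carrier V"
  then have "f v \<in> carrier V'" using assms(2) by (auto simp: module_hom_def)
  then show "(\<lambda>w. b (f v) (g w)) \<in> module_hom K W P"
    by (intro module_hom_compose[OF assms(3)] bilinear_map_homD[OF assms(1)])
next
  fix w assume "w \<in> carrier W"
  then have "g w \<in> carrier W'" using assms(3) by (auto simp: module_hom_def)
  then show "(\<lambda>v. b (f v) (g w)) \<in> module_hom K V P"
    by (intro module_hom_compose[OF assms(2) bilinear_map_homD(2)[OF assms(1)]])
qed

section \<open>Functoriality of the tensor product\<close>

lemma pure_tensor_closed:
  assumes "vectorspace K V" "vectorspace K W" "v \<in> carrier V" "w \<in> carrier W"
  shows "pure_tensor K V W v w \<in> carrier (tensor K V W)"
  using bilinear_map_homD(1)[OF pure_tensor_bilinear[OF assms(1,2)] assms(3)] assms(4)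
  by (auto simp: module_hom_def)

text \<open>Every tensor is a finite sum of pure tensors, scalars being absorbed into a factor, so
  additivity propagates agreement from pure tensors to the whole space. The tensor identities below
  are reduced to pure tensors through this.\<close>

lemma tensor_hom_eqI:
  assumes V: "vectorspace K V" and W: "vectorspace K W" and P: "vectorspace K P"
    and f: "f \<in> module_hom K (tensor K V W) P" and g: "g \<in> module_hom K (tensor K V W) P"
    and eq: "\<And>v w. v \<in> carrier V \<Longrightarrow> w \<in> carrier W \<Longrightarrow>
      f (pure_tensor K V W v w) = g (pure_tensor K V W v w)"
    and t: "t \<in> carrier (tensor K V W)"
  shows "f t = g t"
proof -
  interpret T: vectorspace K "tensor K V W" by (rule tensor_vectorspace[OF V W])
  interpret f: linear_map K "tensor K V W" P f
    by (rule linear_mapI[OF T.vectorspace_axioms P f])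
  interpret g: linear_map K "tensor K V W" P g
    by (rule linear_mapI[OF T.vectorspace_axioms P g])
  show ?thesis
    using t
    by (induction rule: tensor_induct[OF V W, consumes 1]) (simp_all add: eq pure_tensor_closed[OF V W])
qed

text \<open>Additivity and homogeneity in \<open>u\<close> are equations between homomorphisms of
  the tensor \<open>t\<close>, and on pure tensors they hold by \<open>b_hom\<close>. This serves
  the nested lifts in \<open>tensor_flip12\<close> and \<open>tensor_assoc\<close>: the outer lift
  has its universal property only once the inner one is known to be bilinear.\<close>

lemma tensor_lift_bilinear:
  assumes U: "vectorspace K U" and V: "vectorspace K V" and W: "vectorspace K W"
    and P: "vectorspace K P"
    and b: "\<And>u. u \<in> carrier U \<Longrightarrow> bilinear_map K V W P (b u)"
    and b_hom: "\<And>v w. v \<in> carrier V \<Longrightarrow> w \<in> carrier W \<Longrightarrow> (\<lambda>u. b u v w) \<in> module_hom K U P"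
  shows "bilinear_map K U (tensor K V W) P (\<lambda>u. tensor_lift K V W P (b u))"
proof -
  interpret U: vectorspace K U by (rule U)
  interpret P: vectorspace K P by (rule P)
  note hom = tensor_lift(1)[OF V W P b] and pure = tensor_lift(2)[OF V W P b]
  note Pm = P.module_axioms
  have closed: "tensor_lift K V W P (b u) t \<in> carrier P"
    if "u \<in> carrier U" "t \<in> carrier (tensor K V W)" for u t
    using hom[OF that(1)] that(2) by (auto simp: module_hom_def)
  have "tensor_lift K V W P (b (u \<oplus>\<^bsub>U\<^esub> u')) t
      = tensor_lift K V W P (b u) t \<oplus>\<^bsub>P\<^esub> tensor_lift K V W P (b u') t"
    if u: "u \<in> carrier U" "u' \<in> carrier U" and t: "t \<in> carrier (tensor K V W)" for u u' t
    by (rule tensor_hom_eqI[OF V W P hom module_hom_pointwise_add[OF Pm hom hom] _ t])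
      (use u in \<open>simp_all add: pure module_hom_add[OF b_hom]\<close>)
  moreover have "tensor_lift K V W P (b (c \<odot>\<^bsub>U\<^esub> u)) t = c \<odot>\<^bsub>P\<^esub> tensor_lift K V W P (b u) t"
    if u: "c \<in> carrier K" "u \<in> carrier U" and t: "t \<in> carrier (tensor K V W)" for c u t
    by (rule tensor_hom_eqI[OF V W P hom module_hom_pointwise_smult[OF Pm _ hom] _ t])
      (use u in \<open>simp_all add: pure module_hom_smult[OF b_hom]\<close>)
  ultimately have "(\<lambda>u. tensor_lift K V W P (b u) t) \<in> module_hom K U P"
    if "t \<in> carrier (tensor K V W)" for t
    using that closed by (auto simp: module_hom_def)
  then show ?thesis
    using hom by (auto simp: bilinear_map_def)
qed

context
  fixes K :: "('k, 'r) ring_scheme"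
    and V :: "('k, 'v, 'e1) module_scheme" and W :: "('k, 'w, 'e2) module_scheme"
    and V' :: "('k, 'v2, 'e3) module_scheme" and W' :: "('k, 'w2, 'e4) module_scheme"
    and f g
  assumes V: "vectorspace K V" and W: "vectorspace K W"
    and V': "vectorspace K V'" and W': "vectorspace K W'"
    and f: "f \<in> module_hom K V V'" and g: "g \<in> module_hom K W W'"
begin

lemma tensor_map_bilinear:
  "bilinear_map K V W (tensor K V' W') (\<lambda>v w. pure_tensor K V' W' (f v) (g w))"
  by (rule bilinear_map_precompose[OF pure_tensor_bilinear[OF V' W'] f g])

lemma tensor_map_hom:
  "tensor_map K V W V' W' f g \<in> module_hom K (tensor K V W) (tensor K V' W')"
  unfolding tensor_map_def
  by (rule tensor_lift(1)[OF V W tensor_vectorspace[OF V' W'] tensor_map_bilinear])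

lemma tensor_map_pure:
  "v \<in> carrier V \<Longrightarrow> w \<in> carrier W \<Longrightarrow>
    tensor_map K V W V' W' f g (pure_tensor K V W v w) = pure_tensor K V' W' (f v) (g w)"
  unfolding tensor_map_def
  by (rule tensor_lift(2)[OF V W tensor_vectorspace[OF V' W'] tensor_map_bilinear])

lemma tensor_map_closed:
  "t \<in> carrier (tensor K V W) \<Longrightarrow> tensor_map K V W V' W' f g t \<in> carrier (tensor K V' W')"
  using tensor_map_hom by (auto simp: module_hom_def)

end

text \<open>On pure tensors both sides are \<open>f'' v \<otimes> g'' w\<close>. The composites
  enter through equations on the carriers only, so \<open>f''\<close> and \<open>g''\<close> may be
  any homomorphisms agreeing with them there; this later allows \<open>inj1\<close> in place of the
  restriction of \<phi> to G.\<close>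

lemma tensor_map_eq_compose:
  assumes V: "vectorspace K V" and W: "vectorspace K W"
    and V': "vectorspace K V'" and W': "vectorspace K W'"
    and V'': "vectorspace K V''" and W'': "vectorspace K W''"
    and f: "f \<in> module_hom K V V'" and g: "g \<in> module_hom K W W'"
    and f': "f' \<in> module_hom K V' V''" and g': "g' \<in> module_hom K W' W''"
    and f'': "f'' \<in> module_hom K V V''" and g'': "g'' \<in> module_hom K W W''"
    and eq: "\<And>v. v \<in> carrier V \<Longrightarrow> f' (f v) = f'' v" "\<And>w. w \<in> carrier W \<Longrightarrow> g' (g w) = g'' w"
    and t: "t \<in> carrier (tensor K V W)"
  shows "tensor_map K V' W' V'' W'' f' g' (tensor_map K V W V' W' f g t)
    = tensor_map K V W V'' W'' f'' g'' t"
proof -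
  have fc: "v \<in> carrier V \<Longrightarrow> f v \<in> carrier V'" "w \<in> carrier W \<Longrightarrow> g w \<in> carrier W'" for v w
    using f g by (auto simp: module_hom_def)
  show ?thesis
    by (rule tensor_hom_eqI[OF V W tensor_vectorspace[OF V'' W'']
          module_hom_compose[OF tensor_map_hom[OF V W V' W' f g] tensor_map_hom[OF V' W' V'' W'' f' g']]
          tensor_map_hom[OF V W V'' W'' f'' g''] _ t])
      (simp add: tensor_map_pure[OF V W V' W' f g] tensor_map_pure[OF V' W' V'' W'' f' g']
        tensor_map_pure[OF V W V'' W'' f'' g''] fc eq)
qed

context
  fixes K :: "('k, 'r) ring_scheme"
    and V :: "('k, 'v, 'e1) module_scheme" and W :: "('k, 'w, 'e2) module_scheme"
  assumes V: "vectorspace K V" and W: "vectorspace K W"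
begin

private lemma flip_bilinear: "bilinear_map K V W (tensor K W V) (\<lambda>v w. pure_tensor K W V w v)"
  by (rule bilinear_map_swap[OF pure_tensor_bilinear[OF W V]])

lemma tensor_flip_hom: "tensor_flip K V W \<in> module_hom K (tensor K V W) (tensor K W V)"
  unfolding tensor_flip_def
  by (rule tensor_lift(1)[OF V W tensor_vectorspace[OF W V] flip_bilinear])

lemma tensor_flip_pure:
  "v \<in> carrier V \<Longrightarrow> w \<in> carrier W \<Longrightarrow>
    tensor_flip K V W (pure_tensor K V W v w) = pure_tensor K W V w v"
  unfolding tensor_flip_def
  by (rule tensor_lift(2)[OF V W tensor_vectorspace[OF W V] flip_bilinear])

end

text \<open>On \<open>v \<otimes> w\<close> both sides give
  \<open>g w \<otimes> f v\<close>.\<close>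

lemma tensor_flip_natural:
  assumes V: "vectorspace K V" and W: "vectorspace K W"
    and V': "vectorspace K V'" and W': "vectorspace K W'"
    and f: "f \<in> module_hom K V V'" and g: "g \<in> module_hom K W W'"
    and t: "t \<in> carrier (tensor K V W)"
  shows "tensor_flip K V' W' (tensor_map K V W V' W' f g t)
    = tensor_map K W V W' V' g f (tensor_flip K V W t)"
proof -
  have fc: "v \<in> carrier V \<Longrightarrow> f v \<in> carrier V'" "w \<in> carrier W \<Longrightarrow> g w \<in> carrier W'" for v w
    using f g by (auto simp: module_hom_def)
  show ?thesis
    by (rule tensor_hom_eqI[OF V W tensor_vectorspace[OF W' V']
          module_hom_compose[OF tensor_map_hom[OF V W V' W' f g] tensor_flip_hom[OF V' W']]
          module_hom_compose[OF tensor_flip_hom[OF V W] tensor_map_hom[OF W V W' V' g f]] _ t])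
      (simp add: tensor_map_pure[OF V W V' W' f g] tensor_map_pure[OF W V W' V' g f]
        tensor_flip_pure[OF V W] tensor_flip_pure[OF V' W'] fc)
qed

context
  fixes K :: "('k, 'r) ring_scheme" and U :: "('k, 'u, 'e0) module_scheme"
    and V :: "('k, 'v, 'e1) module_scheme" and W :: "('k, 'w, 'e2) module_scheme"
  assumes U: "vectorspace K U" and V: "vectorspace K V" and W: "vectorspace K W"
begin

private lemma UV: "vectorspace K (tensor K U V)" by (rule tensor_vectorspace[OF U V])
private lemma UW: "vectorspace K (tensor K U W)" by (rule tensor_vectorspace[OF U W])
private lemma VW: "vectorspace K (tensor K V W)" by (rule tensor_vectorspace[OF V W])
private lemma U_VW: "vectorspace K (tensor K U (tensor K V W))" by (rule tensor_vectorspace[OF U VW])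
private lemma V_UW: "vectorspace K (tensor K V (tensor K U W))" by (rule tensor_vectorspace[OF V UW])

text \<open>With \<open>u\<close> fixed, this is the outer pure tensor preceded by the identity in
  \<open>v\<close> and by \<open>w \<mapsto> u \<otimes> w\<close> in \<open>w\<close>.\<close>

private lemma flip12_inner_bilinear:
  assumes "u \<in> carrier U"
  shows "bilinear_map K V W (tensor K V (tensor K U W))
    (\<lambda>v w. pure_tensor K V (tensor K U W) v (pure_tensor K U W u w))"
  by (rule bilinear_map_precompose[OF pure_tensor_bilinear[OF V UW] _
        bilinear_map_homD(1)[OF pure_tensor_bilinear[OF U W] assms], where f = "\<lambda>v. v"])
    (simp add: module_hom_def)

private lemma flip12_bilinear:
  "bilinear_map K U (tensor K V W) (tensor K V (tensor K U W))
    (\<lambda>u. tensor_lift K V W (tensor K V (tensor K U W))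
      (\<lambda>v w. pure_tensor K V (tensor K U W) v (pure_tensor K U W u w)))"
  by (rule tensor_lift_bilinear[OF U V W V_UW flip12_inner_bilinear])
    (auto intro: module_hom_compose[OF bilinear_map_homD(2)[OF pure_tensor_bilinear[OF U W]]]
      bilinear_map_homD(1)[OF pure_tensor_bilinear[OF V UW]])

lemma tensor_flip12_hom:
  "tensor_flip12 K U V W
    \<in> module_hom K (tensor K U (tensor K V W)) (tensor K V (tensor K U W))"
  unfolding tensor_flip12_def by (rule tensor_lift(1)[OF U VW V_UW flip12_bilinear])

lemma tensor_flip12_pure:
  assumes "u \<in> carrier U" "v \<in> carrier V" "w \<in> carrier W"
  shows "tensor_flip12 K U V W (pure_tensor K U (tensor K V W) u (pure_tensor K V W v w))
    = pure_tensor K V (tensor K U W) v (pure_tensor K U W u w)"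
  unfolding tensor_flip12_def
  using assms
  by (simp add: tensor_lift(2)[OF U VW V_UW flip12_bilinear] pure_tensor_closed[OF V W]
      tensor_lift(2)[OF V W V_UW flip12_inner_bilinear])

private lemma assoc_inner_bilinear:
  assumes "w \<in> carrier W"
  shows "bilinear_map K U V (tensor K U (tensor K V W))
    (\<lambda>u v. pure_tensor K U (tensor K V W) u (pure_tensor K V W v w))"
  by (rule bilinear_map_precompose[OF pure_tensor_bilinear[OF U VW] _
        bilinear_map_homD(2)[OF pure_tensor_bilinear[OF V W] assms], where f = "\<lambda>u. u"])
    (simp add: module_hom_def)

text \<open>In the associator the lifted tensor comes first and the parameter \<open>w\<close>
  second, opposite to \<open>tensor_lift_bilinear\<close>, whence the swap.\<close>

private lemma assoc_bilinear:
  "bilinear_map K (tensor K U V) W (tensor K U (tensor K V W))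
    (\<lambda>t w. tensor_lift K U V (tensor K U (tensor K V W))
      (\<lambda>u v. pure_tensor K U (tensor K V W) u (pure_tensor K V W v w)) t)"
  by (rule bilinear_map_swap, rule tensor_lift_bilinear[OF W U V U_VW assoc_inner_bilinear])
    (auto intro: module_hom_compose[OF bilinear_map_homD(1)[OF pure_tensor_bilinear[OF V W]]]
      bilinear_map_homD(1)[OF pure_tensor_bilinear[OF U VW]])

lemma tensor_assoc_hom:
  "tensor_assoc K U V W
    \<in> module_hom K (tensor K (tensor K U V) W) (tensor K U (tensor K V W))"
  unfolding tensor_assoc_def by (rule tensor_lift(1)[OF UV W U_VW assoc_bilinear])

lemma tensor_assoc_pure:
  assumes "u \<in> carrier U" "v \<in> carrier V" "w \<in> carrier W"
  shows "tensor_assoc K U V W (pure_tensor K (tensor K U V) W (pure_tensor K U V u v) w)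
    = pure_tensor K U (tensor K V W) u (pure_tensor K V W v w)"
  unfolding tensor_assoc_def
  using assms
  by (simp add: tensor_lift(2)[OF UV W U_VW assoc_bilinear] pure_tensor_closed[OF U V]
      tensor_lift(2)[OF U V U_VW assoc_inner_bilinear])

text \<open>The reduction to pure tensors is applied to the outer product and then, with
  \<open>u\<close> fixed, to the inner one, along the linear map
  \<open>s \<mapsto> u \<otimes> s\<close>.\<close>

lemma tensor_right_hom_eqI:
  assumes P: "vectorspace K P"
    and f: "f \<in> module_hom K (tensor K U (tensor K V W)) P"
    and g: "g \<in> module_hom K (tensor K U (tensor K V W)) P"
    and eq: "\<And>u v w. u \<in> carrier U \<Longrightarrow> v \<in> carrier V \<Longrightarrow> w \<in> carrier W \<Longrightarrow>
      f (pure_tensor K U (tensor K V W) u (pure_tensor K V W v w))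
        = g (pure_tensor K U (tensor K V W) u (pure_tensor K V W v w))"
    and t: "t \<in> carrier (tensor K U (tensor K V W))"
  shows "f t = g t"
proof (rule tensor_hom_eqI[OF U VW P f g _ t])
  fix u s assume u: "u \<in> carrier U" and s: "s \<in> carrier (tensor K V W)"
  note pure = bilinear_map_homD(1)[OF pure_tensor_bilinear[OF U VW] u]
  show "f (pure_tensor K U (tensor K V W) u s) = g (pure_tensor K U (tensor K V W) u s)"
    by (rule tensor_hom_eqI[OF V W P module_hom_compose[OF pure f] module_hom_compose[OF pure g] _ s])
      (rule eq[OF u])
qed

text \<open>The same two-stage reduction for the other bracketing; here the last factor is fixed
  while the inner product varies.\<close>

lemma tensor_left_hom_eqI:
  assumes P: "vectorspace K P"
    and f: "f \<in> module_hom K (tensor K (tensor K U V) W) P"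
    and g: "g \<in> module_hom K (tensor K (tensor K U V) W) P"
    and eq: "\<And>u v w. u \<in> carrier U \<Longrightarrow> v \<in> carrier V \<Longrightarrow> w \<in> carrier W \<Longrightarrow>
      f (pure_tensor K (tensor K U V) W (pure_tensor K U V u v) w)
        = g (pure_tensor K (tensor K U V) W (pure_tensor K U V u v) w)"
    and t: "t \<in> carrier (tensor K (tensor K U V) W)"
  shows "f t = g t"
proof (rule tensor_hom_eqI[OF UV W P f g _ t])
  fix s w assume s: "s \<in> carrier (tensor K U V)" and w: "w \<in> carrier W"
  note pure = bilinear_map_homD(2)[OF pure_tensor_bilinear[OF UV W] w]
  show "f (pure_tensor K (tensor K U V) W s w) = g (pure_tensor K (tensor K U V) W s w)"
    by (rule tensor_hom_eqI[OF U V P module_hom_compose[OF pure f] module_hom_compose[OF pure g] _ s])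
      (rule eq[OF _ _ w])
qed

end

section \<open>Transport of Lie coalgebra structures\<close>

text \<open>The flip, \<open>tensor_flip12\<close> and the associator commute with the tensor powers
  of \<phi>, so applying these powers to the axioms for \<delta> at \<open>x\<close> gives the
  axioms for \<epsilon> at \<open>\<phi> x\<close>; by surjectivity this covers all of M.\<close>

lemma lie_coalgebra_transport:
  assumes "lie_coalgebra K L \<delta>" and M: "vectorspace K M"
    and \<phi>: "\<phi> \<in> module_hom K L M" and surj: "\<phi> ` carrier L = carrier M"
    and \<epsilon>: "\<And>x. x \<in> carrier L \<Longrightarrow> \<epsilon> (\<phi> x) = tensor_map K L L M M \<phi> \<phi> (\<delta> x)"
  shows "lie_coalgebra K M \<epsilon>"
proof -
  interpret L: lie_coalgebra K L \<delta> by fact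
  interpret M: vectorspace K M by (rule M)
  have L: "vectorspace K L" by (rule L.V.vectorspace_axioms)
  note LL = tensor_vectorspace[OF L L] and MM = tensor_vectorspace[OF M M]
  note LLL = tensor_vectorspace[OF L LL] and MMM = tensor_vectorspace[OF M MM]
  interpret LL: vectorspace K "tensor K L L" by (rule LL)
  interpret MM: vectorspace K "tensor K M M" by (rule MM)
  interpret LLL: vectorspace K "tensor K L (tensor K L L)" by (rule LLL)
  interpret MMM: vectorspace K "tensor K M (tensor K M M)" by (rule MMM)
  have \<delta>: "\<delta> \<in> module_hom K L (tensor K L L)" by (rule L.f_hom)
  have \<phi>c: "\<phi> x \<in> carrier M" if "x \<in> carrier L" for x
    using that \<phi> by (auto simp: module_hom_def)
  have idL: "(\<lambda>y. y) \<in> module_hom K L L" and idM: "(\<lambda>y. y) \<in> module_hom K M M"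
    by (auto simp: module_hom_def)
  let ?\<phi>2 = "tensor_map K L L M M \<phi> \<phi>"
  have \<phi>2: "?\<phi>2 \<in> module_hom K (tensor K L L) (tensor K M M)"
    by (rule tensor_map_hom[OF L L M M \<phi> \<phi>])
  interpret \<phi>2: linear_map K "tensor K L L" "tensor K M M" ?\<phi>2
    by (rule linear_mapI[OF LL MM \<phi>2])
  let ?\<phi>3 = "tensor_map K L (tensor K L L) M (tensor K M M) \<phi> ?\<phi>2"
  have \<phi>3: "?\<phi>3 \<in> module_hom K (tensor K L (tensor K L L)) (tensor K M (tensor K M M))"
    by (rule tensor_map_hom[OF L LL M MM \<phi> \<phi>2])
  interpret \<phi>3: linear_map K "tensor K L (tensor K L L)" "tensor K M (tensor K M M)" ?\<phi>3
    by (rule linear_mapI[OF LLL MMM \<phi>3])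
  note \<phi>2_pure = tensor_map_pure[OF L L M M \<phi> \<phi>] and \<phi>3_pure = tensor_map_pure[OF L LL M MM \<phi> \<phi>2]
  \<comment> \<open>Writing \<open>carrier M\<close> as the image of \<phi> reduces linearity of
    \<epsilon> to that of \<open>x \<mapsto> ?\<phi>2 (\<delta> x)\<close>.\<close>
  have \<epsilon>_hom: "\<epsilon> \<in> module_hom K M (tensor K M M)"
  proof -
    have "\<epsilon> (\<phi> x) \<in> carrier (tensor K M M)" if "x \<in> carrier L" for x
      using that by (simp add: \<epsilon>)
    moreover have "\<epsilon> (\<phi> x \<oplus>\<^bsub>M\<^esub> \<phi> y) = \<epsilon> (\<phi> x) \<oplus>\<^bsub>tensor K M M\<^esub> \<epsilon> (\<phi> y)"
      if "x \<in> carrier L" "y \<in> carrier L" for x y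
      using that by (simp add: \<epsilon> flip: module_hom_add[OF \<phi>])
    moreover have "\<epsilon> (c \<odot>\<^bsub>M\<^esub> \<phi> x) = c \<odot>\<^bsub>tensor K M M\<^esub> \<epsilon> (\<phi> x)"
      if "c \<in> carrier K" "x \<in> carrier L" for c x
      using that by (simp add: \<epsilon> flip: module_hom_smult[OF \<phi>])
    ultimately show ?thesis
      unfolding module_hom_def surj[symmetric] by auto
  qed
  have flip: "tensor_flip K M M (?\<phi>2 t) = ?\<phi>2 (tensor_flip K L L t)"
    if "t \<in> carrier (tensor K L L)" for t
    by (rule tensor_flip_natural[OF L L M M \<phi> \<phi> that])
  \<comment> \<open>On \<open>x \<otimes> y\<close> the left side is
    \<open>\<phi> x \<otimes> \<epsilon> (\<phi> y)\<close> and the right side is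
    \<open>\<phi> x \<otimes> ?\<phi>2 (\<delta> y)\<close>; the assumption on \<epsilon> identifies
    them.\<close>
  have right: "tensor_map K M M M (tensor K M M) (\<lambda>y. y) \<epsilon> (?\<phi>2 t)
      = ?\<phi>3 (tensor_map K L L L (tensor K L L) (\<lambda>y. y) \<delta> t)"
    if t: "t \<in> carrier (tensor K L L)" for t
    by (rule tensor_hom_eqI[OF L L MMM
          module_hom_compose[OF \<phi>2 tensor_map_hom[OF M M M MM idM \<epsilon>_hom]]
          module_hom_compose[OF tensor_map_hom[OF L L L LL idL \<delta>] \<phi>3] _ t])
      (simp add: \<phi>2_pure \<phi>3_pure tensor_map_pure[OF M M M MM idM \<epsilon>_hom]
        tensor_map_pure[OF L L L LL idL \<delta>] \<phi>c \<epsilon>)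
  have flip12: "tensor_flip12 K M M M (?\<phi>3 t) = ?\<phi>3 (tensor_flip12 K L L L t)"
    if t: "t \<in> carrier (tensor K L (tensor K L L))" for t
    by (rule tensor_right_hom_eqI[OF L L L MMM
          module_hom_compose[OF \<phi>3 tensor_flip12_hom[OF M M M]]
          module_hom_compose[OF tensor_flip12_hom[OF L L L] \<phi>3] _ t])
      (simp add: \<phi>2_pure \<phi>3_pure tensor_flip12_pure[OF M M M] tensor_flip12_pure[OF L L L]
        \<phi>c pure_tensor_closed[OF L L])
  \<comment> \<open>\<open>(\<delta> \<otimes> I) \<delta>\<close> takes values in the left-nested
    triple product, so the threefold power of \<phi> is needed in this bracketing too; the
    associator relates it to \<open>?\<phi>3\<close>.\<close>
  let ?\<phi>3' = "tensor_map K (tensor K L L) L (tensor K M M) M ?\<phi>2 \<phi>"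
  have left: "tensor_map K M M (tensor K M M) M \<epsilon> (\<lambda>y. y) (?\<phi>2 t)
      = ?\<phi>3' (tensor_map K L L (tensor K L L) L \<delta> (\<lambda>y. y) t)"
    if t: "t \<in> carrier (tensor K L L)" for t
    by (rule tensor_hom_eqI[OF L L tensor_vectorspace[OF MM M]
          module_hom_compose[OF \<phi>2 tensor_map_hom[OF M M MM M \<epsilon>_hom idM]]
          module_hom_compose[OF tensor_map_hom[OF L L LL L \<delta> idL] tensor_map_hom[OF LL L MM M \<phi>2 \<phi>]] _ t])
      (simp add: \<phi>2_pure tensor_map_pure[OF LL L MM M \<phi>2 \<phi>] tensor_map_pure[OF M M MM M \<epsilon>_hom idM]
        tensor_map_pure[OF L L LL L \<delta> idL] \<phi>c \<epsilon>)
  have assoc: "tensor_assoc K M M M (?\<phi>3' t) = ?\<phi>3 (tensor_assoc K L L L t)"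
    if t: "t \<in> carrier (tensor K (tensor K L L) L)" for t
    by (rule tensor_left_hom_eqI[OF L L L MMM
          module_hom_compose[OF tensor_map_hom[OF LL L MM M \<phi>2 \<phi>] tensor_assoc_hom[OF M M M]]
          module_hom_compose[OF tensor_assoc_hom[OF L L L] \<phi>3] _ t])
      (simp add: \<phi>2_pure \<phi>3_pure tensor_map_pure[OF LL L MM M \<phi>2 \<phi>]
        tensor_assoc_pure[OF M M M] tensor_assoc_pure[OF L L L] \<phi>c pure_tensor_closed[OF L L])
  have flip_closed: "tensor_flip K L L t \<in> carrier (tensor K L L)"
    if "t \<in> carrier (tensor K L L)" for t
    using that tensor_flip_hom[OF L L] by (auto simp: module_hom_def)
  have flip12_closed: "tensor_flip12 K L L L t \<in> carrier (tensor K L (tensor K L L))"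
    if "t \<in> carrier (tensor K L (tensor K L L))" for t
    using that tensor_flip12_hom[OF L L L] by (auto simp: module_hom_def)
  show ?thesis
  proof (intro lie_coalgebra.intro lie_coalgebra_axioms.intro linear_mapI[OF M MM \<epsilon>_hom])
    fix m assume "m \<in> carrier M"
    then obtain x where x: "x \<in> carrier L" "m = \<phi> x" using surj by auto
    \<comment> \<open>The antisymmetry equation has \<open>\<delta> x\<close> on both sides, so it
      is applied a single time, under \<open>?\<phi>2\<close>.\<close>
    have "\<epsilon> m = ?\<phi>2 (\<ominus>\<^bsub>tensor K L L\<^esub> tensor_flip K L L (\<delta> x))"
      unfolding x(2) \<epsilon>[OF x(1)] by (rule arg_cong[OF L.co_antisym[OF x(1)]])
    also have "\<dots> = \<ominus>\<^bsub>tensor K M M\<^esub> ?\<phi>2 (tensor_flip K L L (\<delta> x))"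
      using x by (simp add: flip_closed)
    also have "?\<phi>2 (tensor_flip K L L (\<delta> x)) = tensor_flip K M M (\<epsilon> m)"
      using x by (simp add: \<epsilon> flip)
    finally show "\<epsilon> m = \<ominus>\<^bsub>tensor K M M\<^esub> tensor_flip K M M (\<epsilon> m)" .
    let ?r = "tensor_map K L L L (tensor K L L) (\<lambda>y. y) \<delta> (\<delta> x)"
    have rc: "?r \<in> carrier (tensor K L (tensor K L L))"
      using x by (intro tensor_map_closed[OF L L L LL idL \<delta>]) simp
    let ?l = "tensor_map K L L (tensor K L L) L \<delta> (\<lambda>y. y) (\<delta> x)"
    have lc: "?l \<in> carrier (tensor K (tensor K L L) L)"
      using x by (intro tensor_map_closed[OF L L LL L \<delta> idL]) simp
    show "tensor_map K M M M (tensor K M M) (\<lambda>y. y) \<epsilon> (\<epsilon> m)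
        \<ominus>\<^bsub>tensor K M (tensor K M M)\<^esub>
          tensor_flip12 K M M M (tensor_map K M M M (tensor K M M) (\<lambda>y. y) \<epsilon> (\<epsilon> m))
      = tensor_assoc K M M M (tensor_map K M M (tensor K M M) M \<epsilon> (\<lambda>y. y) (\<epsilon> m))"
    proof -
      \<comment> \<open>Linearity of \<open>?\<phi>3\<close> and its commutation with
        \<open>tensor_flip12\<close> pull the whole co-Jacobi difference back to L, where the axiom
        for \<delta> applies.\<close>
      have "?\<phi>3 ?r \<ominus>\<^bsub>tensor K M (tensor K M M)\<^esub> tensor_flip12 K M M M (?\<phi>3 ?r)
          = ?\<phi>3 (?r \<ominus>\<^bsub>tensor K L (tensor K L L)\<^esub> tensor_flip12 K L L L ?r)"
        using rc by (simp add: flip12 flip12_closed)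
      also have "\<dots> = tensor_assoc K M M M (?\<phi>3' ?l)"
        unfolding L.co_jacobi[OF x(1)] by (rule assoc[OF lc, symmetric])
      finally show ?thesis
        unfolding x(2) \<epsilon>[OF x(1)] right[OF L.f_im[OF x(1)]] left[OF L.f_im[OF x(1)]] .
    qed
  qed
qed


theorem theorem3p4:
  fixes K :: "('k, 'r) ring_scheme"
    and E :: "('k, 'e) module"
    and G V :: "'e set"
    and \<delta>\<^sub>G :: "'e \<Rightarrow> ('e \<times> 'e \<Rightarrow> 'k) set"
    and \<delta>\<^sub>E :: "'e \<Rightarrow> ('e \<times> 'e \<Rightarrow> 'k) set"
  defines "\<gg> \<equiv> E\<lparr>carrier := G\<rparr>"
    and "\<vv> \<equiv> E\<lparr>carrier := V\<rparr>"
  assumes "field K"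
    and char_0: "\<And>n::nat. n > 0 \<Longrightarrow> [n] \<cdot>\<^bsub>K\<^esub> \<one>\<^bsub>K\<^esub> \<noteq> \<zero>\<^bsub>K\<^esub>"
    and "vectorspace K E"
    and "subspace K G E"
    and "lie_coalgebra K \<gg> \<delta>\<^sub>G"
    and "complement K G V E"
    and "lie_coalgebra K E \<delta>\<^sub>E"
    and "lie_subcoalgebra K G \<delta>\<^sub>G E \<delta>\<^sub>E"
  shows "\<exists>\<Delta>\<^sub>E \<Delta>\<^sub>V \<delta>\<^sub>V.
    lie_coalgebraic_extending_structure K \<gg> \<delta>\<^sub>G \<vv> \<Delta>\<^sub>E \<Delta>\<^sub>V \<delta>\<^sub>V \<and>
    (\<exists>\<phi>. lie_coalgebra_iso K E \<delta>\<^sub>E (direct_sum \<gg> \<vv>)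
             (unified_cobracket K \<gg> \<delta>\<^sub>G \<vv> \<Delta>\<^sub>E \<Delta>\<^sub>V \<delta>\<^sub>V) \<phi> \<and>
          (\<forall>a\<in>G. \<phi> a = inj1 \<gg> \<vv> a))"
proof -

  \<comment> \<open>The subspaces G and V and their external direct sum\<close>
  interpret E: vectorspace K E by fact
  interpret sub: lie_subcoalgebra K G \<delta>\<^sub>G E \<delta>\<^sub>E by fact
  have E: "vectorspace K E" by fact
  have G_sub: "subspace K G E" and V_sub: "subspace K V E"
    and sum: "E.submodule_sum G V = carrier E" and int: "G \<inter> V = {\<zero>\<^bsub>E\<^esub>}"
    using \<open>complement K G V E\<close> by (auto simp: complement_def)
  interpret G: submodule K G E using G_sub by (simp add: subspace_def)
  interpret V: submodule K V E using V_sub by (simp add: subspace_def)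
  have g: "vectorspace K \<gg>" unfolding \<gg>_def by (rule E.subspace_is_vs[OF G_sub])
  have v: "vectorspace K \<vv>" unfolding \<vv>_def by (rule E.subspace_is_vs[OF V_sub])
  define S where "S = direct_sum \<gg> \<vv>"
  have S: "vectorspace K S" unfolding S_def by (rule direct_sum_is_vs[OF g v])
  interpret g: vectorspace K \<gg> by (rule g)
  interpret v: vectorspace K \<vv> by (rule v)
  interpret S: vectorspace K S by (rule S)
  have S_simps: "carrier S = G \<times> V" "s \<oplus>\<^bsub>S\<^esub> t = (fst s \<oplus>\<^bsub>E\<^esub> fst t, snd s \<oplus>\<^bsub>E\<^esub> snd t)"
      "c \<odot>\<^bsub>S\<^esub> s = (c \<odot>\<^bsub>E\<^esub> fst s, c \<odot>\<^bsub>E\<^esub> snd s)" for s t c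
    by (simp_all add: S_def direct_sum_def \<gg>_def \<vv>_def)

  \<comment> \<open>The addition map from the direct sum onto E\<close>
  define \<sigma> where "\<sigma> = (\<lambda>s. fst s \<oplus>\<^bsub>E\<^esub> snd s)"
  interpret \<sigma>: linear_map K S E \<sigma>
    using E.sum_map_linear[OF G_sub V_sub] by (simp add: \<sigma>_def S_def \<gg>_def \<vv>_def)
  have \<sigma>_bij: "bij_betw \<sigma> (carrier S) (carrier E)"
  proof (rule bij_betw_imageI)
    show "inj_on \<sigma> (carrier S)"
    proof (rule inj_onI)
      fix s t assume s: "s \<in> carrier S" and t: "t \<in> carrier S" and eq: "\<sigma> s = \<sigma> t"
      \<comment> \<open>The components of the difference \<open>d\<close> add up to zero, so the
        first is minus the second and lies in both G and V.\<close>
      define d where "d = s \<ominus>\<^bsub>S\<^esub> t"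
      have d: "d \<in> carrier S" using s t by (simp add: d_def)
      have "\<sigma> d = \<zero>\<^bsub>E\<^esub>" using s t eq by (simp add: d_def)
      then have 0: "fst d \<oplus>\<^bsub>E\<^esub> snd d = \<zero>\<^bsub>E\<^esub>" by (simp add: \<sigma>_def)
      have dGV: "fst d \<in> G" "snd d \<in> V" using d by (auto simp: S_simps)
      then have dc: "fst d \<in> carrier E" "snd d \<in> carrier E" using G.subset V.subset by auto
      \<comment> \<open>Negation is written as a scalar multiple, under which V is closed.\<close>
      have fst: "fst d = (\<ominus>\<^bsub>K\<^esub> \<one>\<^bsub>K\<^esub>) \<odot>\<^bsub>E\<^esub> snd d"
        using 0 dc by (simp add: E.smult_minus_1 E.minus_equality)
      then have "fst d \<in> V" using dGV(2) by simp
      then have "fst d = \<zero>\<^bsub>E\<^esub>" using dGV int by auto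
      moreover from this have "snd d = \<zero>\<^bsub>E\<^esub>" using 0 dc by simp
      ultimately have "d = \<zero>\<^bsub>S\<^esub>"
        by (simp add: S_def direct_sum_def \<gg>_def \<vv>_def prod_eq_iff)
      then show "s = t" using s t by (simp add: d_def)
    qed
    show "\<sigma> ` carrier S = carrier E"
      unfolding sum[symmetric] by (force simp: E.submodule_sum_def S_simps \<sigma>_def)
  qed

  \<comment> \<open>The inverse isomorphism and the two projections\<close>
  define \<phi> where "\<phi> = inv_into (carrier S) \<sigma>"
  have \<phi>: "\<phi> \<in> module_hom K E S"
    unfolding \<phi>_def by (rule module_hom_inv_into[OF S.module_axioms \<sigma>.f_hom \<sigma>_bij])
  have \<phi>_bij: "bij_betw \<phi> (carrier E) (carrier S)"
    unfolding \<phi>_def by (rule bij_betw_inv_into[OF \<sigma>_bij])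
  have \<phi>c: "\<phi> e \<in> carrier S" if "e \<in> carrier E" for e
    using that \<phi> by (auto simp: module_hom_def)
  have \<phi>_sum: "\<phi> (a \<oplus>\<^bsub>E\<^esub> x) = (a, x)" if "a \<in> G" "x \<in> V" for a x
    using that inv_into_f_f[OF bij_betw_imp_inj_on[OF \<sigma>_bij], of "(a, x)"]
    by (simp add: \<phi>_def \<sigma>_def S_simps)
  \<comment> \<open>An element of G decomposes with V-component zero.\<close>
  have \<phi>_G: "\<phi> a = inj1 \<gg> \<vv> a" if "a \<in> G" for a
    using that \<phi>_sum[of a "\<zero>\<^bsub>E\<^esub>"] G.subset by (auto simp: inj1_def \<vv>_def)

  define p where "p = (\<lambda>e. fst (\<phi> e))"
  define q where "q = (\<lambda>e. snd (\<phi> e))"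
  have p: "p \<in> module_hom K E \<gg>" and q: "q \<in> module_hom K E \<vv>"
    using \<phi> by (auto simp: module_hom_def p_def q_def S_simps \<gg>_def \<vv>_def Pi_iff mem_Times_iff)
  let ?i = "inj1 \<gg> \<vv>" and ?j = "inj2 \<gg> \<vv>"
  have i: "?i \<in> module_hom K \<gg> S" and j: "?j \<in> module_hom K \<vv> S"
    using inj1_hom[OF g.module_axioms v.module_axioms] inj2_hom[OF g.module_axioms v.module_axioms]
    by (simp_all add: S_def mod_hom_def mod_hom_axioms_def)
  note ip = module_hom_compose[OF p i] and jq = module_hom_compose[OF q j]
  have \<phi>_split: "\<phi> e = ?i (p e) \<oplus>\<^bsub>S\<^esub> ?j (q e)" if "e \<in> carrier E" for e
  proof -
    \<comment> \<open>The sum to be computed is \<open>(p e + 0, 0 + q e)\<close>; membership in E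
      lets the zeros contributed by the injections be absorbed.\<close>
    have "p e \<in> carrier E" "q e \<in> carrier E"
      using \<phi>c[OF that] G.subset V.subset by (auto simp: p_def q_def S_simps)
    then show ?thesis
      by (simp add: S_simps inj1_def inj2_def \<gg>_def \<vv>_def) (simp add: p_def q_def)
  qed

  \<comment> \<open>Splitting \<phi> \<otimes> \<phi> into four blocks\<close>
  note tv = tensor_vectorspace
  interpret SS: vectorspace K "tensor K S S" by (rule tv[OF S S])
  interpret EE: vectorspace K "tensor K E E" by (rule tv[OF E E])
  define \<phi>2 where "\<phi>2 = tensor_map K E E S S \<phi> \<phi>"
  have \<phi>2: "\<phi>2 \<in> module_hom K (tensor K E E) (tensor K S S)"
    unfolding \<phi>2_def by (rule tensor_map_hom[OF E E S S \<phi> \<phi>])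
  note hom_gg = tensor_map_hom[OF E E S S ip ip] and hom_gv = tensor_map_hom[OF E E S S ip jq]
    and hom_vg = tensor_map_hom[OF E E S S jq ip] and hom_vv = tensor_map_hom[OF E E S S jq jq]
  have \<phi>2_split: "\<phi>2 t =
      tensor_map K E E S S (\<lambda>e. ?i (p e)) (\<lambda>e. ?i (p e)) t
      \<oplus>\<^bsub>tensor K S S\<^esub> tensor_map K E E S S (\<lambda>e. ?i (p e)) (\<lambda>e. ?j (q e)) t
      \<oplus>\<^bsub>tensor K S S\<^esub> tensor_map K E E S S (\<lambda>e. ?j (q e)) (\<lambda>e. ?i (p e)) t
      \<oplus>\<^bsub>tensor K S S\<^esub> tensor_map K E E S S (\<lambda>e. ?j (q e)) (\<lambda>e. ?j (q e)) t"
    if t: "t \<in> carrier (tensor K E E)" for t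
  proof (rule tensor_hom_eqI[OF E E tv[OF S S] \<phi>2 _ _ t])
    show "(\<lambda>t. tensor_map K E E S S (\<lambda>e. ?i (p e)) (\<lambda>e. ?i (p e)) t
      \<oplus>\<^bsub>tensor K S S\<^esub> tensor_map K E E S S (\<lambda>e. ?i (p e)) (\<lambda>e. ?j (q e)) t
      \<oplus>\<^bsub>tensor K S S\<^esub> tensor_map K E E S S (\<lambda>e. ?j (q e)) (\<lambda>e. ?i (p e)) t
      \<oplus>\<^bsub>tensor K S S\<^esub> tensor_map K E E S S (\<lambda>e. ?j (q e)) (\<lambda>e. ?j (q e)) t)
      \<in> module_hom K (tensor K E E) (tensor K S S)"
      by (intro module_hom_pointwise_add[OF SS.module_axioms] hom_gg hom_gv hom_vg hom_vv)
  next
    fix x y assume xy: "x \<in> carrier E" "y \<in> carrier E"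
    \<comment> \<open>With \<open>\<phi> x = a + b\<close> and \<open>\<phi> y = c + d\<close>, the
      claim is the bilinear expansion of \<open>(a + b) \<otimes> (c + d)\<close>.\<close>
    define a b c d where "a = ?i (p x)" and "b = ?j (q x)" and "c = ?i (p y)" and "d = ?j (q y)"
    have abcd: "a \<in> carrier S" "b \<in> carrier S" "c \<in> carrier S" "d \<in> carrier S"
      using xy ip jq by (auto simp: module_hom_def a_def b_def c_def d_def)
    have add_l: "pure_tensor K S S (s \<oplus>\<^bsub>S\<^esub> s') t
        = pure_tensor K S S s t \<oplus>\<^bsub>tensor K S S\<^esub> pure_tensor K S S s' t"
      and add_r: "pure_tensor K S S t (s \<oplus>\<^bsub>S\<^esub> s')
        = pure_tensor K S S t s \<oplus>\<^bsub>tensor K S S\<^esub> pure_tensor K S S t s'"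
      if "s \<in> carrier S" "s' \<in> carrier S" "t \<in> carrier S" for s s' t
      using that module_hom_add[OF bilinear_map_homD(1)[OF pure_tensor_bilinear[OF S S]]]
        module_hom_add[OF bilinear_map_homD(2)[OF pure_tensor_bilinear[OF S S]]] by auto
    have "\<phi>2 (pure_tensor K E E x y) = pure_tensor K S S (a \<oplus>\<^bsub>S\<^esub> b) (c \<oplus>\<^bsub>S\<^esub> d)"
      using xy by (simp add: \<phi>2_def tensor_map_pure[OF E E S S \<phi> \<phi>] \<phi>_split a_def b_def c_def d_def)
    also have "\<dots> = pure_tensor K S S a c \<oplus>\<^bsub>tensor K S S\<^esub> pure_tensor K S S a d
        \<oplus>\<^bsub>tensor K S S\<^esub> pure_tensor K S S b c \<oplus>\<^bsub>tensor K S S\<^esub> pure_tensor K S S b d"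
      using abcd by (simp add: add_l add_r pure_tensor_closed[OF S S] SS.a_ac)
    finally show "\<phi>2 (pure_tensor K E E x y) =
      tensor_map K E E S S (\<lambda>e. ?i (p e)) (\<lambda>e. ?i (p e)) (pure_tensor K E E x y)
      \<oplus>\<^bsub>tensor K S S\<^esub> tensor_map K E E S S (\<lambda>e. ?i (p e)) (\<lambda>e. ?j (q e)) (pure_tensor K E E x y)
      \<oplus>\<^bsub>tensor K S S\<^esub> tensor_map K E E S S (\<lambda>e. ?j (q e)) (\<lambda>e. ?i (p e)) (pure_tensor K E E x y)
      \<oplus>\<^bsub>tensor K S S\<^esub> tensor_map K E E S S (\<lambda>e. ?j (q e)) (\<lambda>e. ?j (q e)) (pure_tensor K E E x y)"
      using xy by (simp add: tensor_map_pure[OF E E S S ip ip] tensor_map_pure[OF E E S S ip jq]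
          tensor_map_pure[OF E E S S jq ip] tensor_map_pure[OF E E S S jq jq] a_def b_def c_def d_def)
  qed

  \<comment> \<open>The extending datum read off from the cobracket of E\<close>
  have \<delta>E: "\<delta>\<^sub>E \<in> module_hom K E (tensor K E E)" by (rule sub.amb.f_hom)
  have \<delta>E_closed: "\<delta>\<^sub>E e \<in> carrier (tensor K E E)" if "e \<in> carrier E" for e
    using that \<delta>E by (auto simp: module_hom_def)
  have incl_g: "(\<lambda>y. y) \<in> module_hom K \<gg> E" and incl_v: "(\<lambda>y. y) \<in> module_hom K \<vv> E"
    using G.subset V.subset by (auto simp: module_hom_def \<gg>_def \<vv>_def)
  \<comment> \<open>Restricting along the inclusion of V makes the components defined next linear on
    \<vv>.\<close>
  have \<delta>E_v: "\<delta>\<^sub>E \<in> module_hom K \<vv> (tensor K E E)"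
    using module_hom_compose[OF incl_v \<delta>E] .
  define \<Delta>E where "\<Delta>E = (\<lambda>x. tensor_map K E E \<gg> \<vv> p q (\<delta>\<^sub>E x))"
  define \<Delta>V where "\<Delta>V = (\<lambda>x. tensor_map K E E \<gg> \<gg> p p (\<delta>\<^sub>E x))"
  define \<delta>V where "\<delta>V = (\<lambda>x. tensor_map K E E \<vv> \<vv> q q (\<delta>\<^sub>E x))"
  define D where "D = unified_cobracket K \<gg> \<delta>\<^sub>G \<vv> \<Delta>E \<Delta>V \<delta>V"
  have datum: "extending_datum K \<gg> \<vv> \<Delta>E \<Delta>V \<delta>V"
    unfolding extending_datum_def \<Delta>E_def \<Delta>V_def \<delta>V_def
    by (intro conjI linear_mapI v tv g module_hom_compose[OF \<delta>E_v] tensor_map_hom E p q)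

  \<comment> \<open>The unified cobracket as the transported cobracket\<close>
  have D_eq: "D (\<phi> e) = \<phi>2 (\<delta>\<^sub>E e)" if ec: "e \<in> carrier E" for e
  proof -
    \<comment> \<open>\<open>\<phi> e\<close> is the pair \<open>(a, x)\<close>, so in
      \<open>D (\<phi> e)\<close> the summand with \<open>\<delta>\<^sub>G a\<close> has to come
      from \<open>a\<close> and the four others from \<open>x\<close>.\<close>
    obtain a x where a: "a \<in> G" and x: "x \<in> V" and e: "e = a \<oplus>\<^bsub>E\<^esub> x"
      using ec unfolding sum[symmetric] by (auto simp: E.submodule_sum_def)
    have ac: "a \<in> carrier E" and xc: "x \<in> carrier E" using a x G.subset V.subset by auto
    have \<delta>a: "\<delta>\<^sub>G a \<in> carrier (tensor K \<gg> \<gg>)" using sub.sub.f_im[of a] a by (simp add: \<gg>_def)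
    \<comment> \<open>The sub-coalgebra hypothesis presents \<open>\<delta>\<^sub>E a\<close> as the
      image of \<open>\<delta>\<^sub>G a\<close> under the inclusion, and \<phi> after the inclusion
      of G is the first injection.\<close>
    have G_part: "\<phi>2 (\<delta>\<^sub>E a) = tensor_map K \<gg> \<gg> S S ?i ?i (\<delta>\<^sub>G a)"
      unfolding \<phi>2_def sub.restrict_cobracket[OF a] \<gg>_def[symmetric]
      by (rule tensor_map_eq_compose[OF g g E E S S incl_g incl_g \<phi> \<phi> i i _ _ \<delta>a])
        (simp_all add: \<phi>_G \<gg>_def)
    let ?t = "\<delta>\<^sub>E x"
    have t: "?t \<in> carrier (tensor K E E)" by (rule \<delta>E_closed[OF xc])
    \<comment> \<open>Three of the four blocks factor, by functoriality, through the components that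
      define the datum.\<close>
    have gg: "tensor_map K E E S S (\<lambda>e. ?i (p e)) (\<lambda>e. ?i (p e)) ?t
        = tensor_map K \<gg> \<gg> S S ?i ?i (\<Delta>V x)"
      unfolding \<Delta>V_def
      by (rule tensor_map_eq_compose[OF E E g g S S p p i i ip ip refl refl t, symmetric])
    have gv: "tensor_map K E E S S (\<lambda>e. ?i (p e)) (\<lambda>e. ?j (q e)) ?t
        = tensor_map K \<gg> \<vv> S S ?i ?j (\<Delta>E x)"
      unfolding \<Delta>E_def
      by (rule tensor_map_eq_compose[OF E E g v S S p q i j ip jq refl refl t, symmetric])
    have vv: "tensor_map K E E S S (\<lambda>e. ?j (q e)) (\<lambda>e. ?j (q e)) ?t
        = tensor_map K \<vv> \<vv> S S ?j ?j (\<delta>V x)"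
      unfolding \<delta>V_def
      by (rule tensor_map_eq_compose[OF E E v v S S q q j j jq jq refl refl t, symmetric])
    have ft: "tensor_flip K E E ?t \<in> carrier (tensor K E E)"
      using t tensor_flip_hom[OF E E] by (auto simp: module_hom_def)
    interpret m: linear_map K "tensor K E E" "tensor K S S"
        "tensor_map K E E S S (\<lambda>e. ?j (q e)) (\<lambda>e. ?i (p e))"
      by (rule linear_mapI[OF tv[OF E E] tv[OF S S] hom_vg])
    \<comment> \<open>The datum has no component in \<vv> \<otimes> \<gg>. Antisymmetry inserts a
      flip and a sign; naturality then turns \<open>q \<otimes> p\<close> after the flip into the
      flip of \<open>p \<otimes> q\<close>, that is, of \<open>\<Delta>E x\<close>. The sign is the
      minus in the unified cobracket.\<close>
    have vg: "tensor_map K E E S S (\<lambda>e. ?j (q e)) (\<lambda>e. ?i (p e)) ?t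
        = \<ominus>\<^bsub>tensor K S S\<^esub> tensor_map K \<vv> \<gg> S S ?j ?i (tensor_flip K \<gg> \<vv> (\<Delta>E x))"
    proof -
      have "tensor_map K E E S S (\<lambda>e. ?j (q e)) (\<lambda>e. ?i (p e)) ?t
          = tensor_map K E E S S (\<lambda>e. ?j (q e)) (\<lambda>e. ?i (p e))
              (\<ominus>\<^bsub>tensor K E E\<^esub> tensor_flip K E E ?t)"
        by (rule arg_cong[OF sub.amb.co_antisym[OF xc]])
      also have "\<dots> = \<ominus>\<^bsub>tensor K S S\<^esub>
          tensor_map K E E S S (\<lambda>e. ?j (q e)) (\<lambda>e. ?i (p e)) (tensor_flip K E E ?t)"
        using ft by simp
      also have "tensor_map K E E S S (\<lambda>e. ?j (q e)) (\<lambda>e. ?i (p e)) (tensor_flip K E E ?t)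
          = tensor_map K \<vv> \<gg> S S ?j ?i (tensor_map K E E \<vv> \<gg> q p (tensor_flip K E E ?t))"
        by (rule tensor_map_eq_compose[OF E E v g S S q p j i jq ip refl refl ft, symmetric])
      also have "tensor_map K E E \<vv> \<gg> q p (tensor_flip K E E ?t) = tensor_flip K \<gg> \<vv> (\<Delta>E x)"
        unfolding \<Delta>E_def by (rule tensor_flip_natural[OF E E g v p q t, symmetric])
      finally show ?thesis .
    qed
    let ?A = "tensor_map K \<gg> \<gg> S S ?i ?i (\<delta>\<^sub>G a)"
      and ?B = "tensor_map K \<gg> \<vv> S S ?i ?j (\<Delta>E x)"
      and ?C = "tensor_map K \<vv> \<gg> S S ?j ?i (tensor_flip K \<gg> \<vv> (\<Delta>E x))"
      and ?F = "tensor_map K \<gg> \<gg> S S ?i ?i (\<Delta>V x)"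
      and ?H = "tensor_map K \<vv> \<vv> S S ?j ?j (\<delta>V x)"
    have c: "?A \<in> carrier (tensor K S S)" "?B \<in> carrier (tensor K S S)"
      "?F \<in> carrier (tensor K S S)" "?H \<in> carrier (tensor K S S)"
      using tensor_map_closed[OF g g S S i i \<delta>a] tensor_map_closed[OF E E S S ip ip t]
        tensor_map_closed[OF E E S S ip jq t] tensor_map_closed[OF E E S S jq jq t]
      by (simp_all add: gg gv vv)
    have cC: "?C \<in> carrier (tensor K S S)"
    proof -
      have "\<Delta>E x \<in> carrier (tensor K \<gg> \<vv>)"
        unfolding \<Delta>E_def by (rule tensor_map_closed[OF E E g v p q t])
      then have "tensor_flip K \<gg> \<vv> (\<Delta>E x) \<in> carrier (tensor K \<vv> \<gg>)"
        using tensor_flip_hom[OF g v] by (auto simp: module_hom_def)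
      then show ?thesis by (rule tensor_map_closed[OF v g S S j i])
    qed
    have "\<phi>2 (\<delta>\<^sub>E e) = \<phi>2 (\<delta>\<^sub>E a) \<oplus>\<^bsub>tensor K S S\<^esub> \<phi>2 ?t"
      using ac xc by (simp add: e module_hom_add[OF \<delta>E] module_hom_add[OF \<phi>2] \<delta>E_closed)
    also have "\<dots> = ?A \<oplus>\<^bsub>tensor K S S\<^esub>
        (?F \<oplus>\<^bsub>tensor K S S\<^esub> ?B \<oplus>\<^bsub>tensor K S S\<^esub> \<ominus>\<^bsub>tensor K S S\<^esub> ?C \<oplus>\<^bsub>tensor K S S\<^esub> ?H)"
      by (simp only: G_part \<phi>2_split[OF t] gg gv vg vv)
    \<comment> \<open>The blocks are rearranged into the order in which
      \<open>unified_cobracket\<close> lists them.\<close>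
    also have "\<dots> = ?A \<oplus>\<^bsub>tensor K S S\<^esub> ?B \<ominus>\<^bsub>tensor K S S\<^esub> ?C
        \<oplus>\<^bsub>tensor K S S\<^esub> ?F \<oplus>\<^bsub>tensor K S S\<^esub> ?H"
      using c cC by (simp add: a_minus_def SS.a_ac)
    also have "\<dots> = D (\<phi> e)"
      using \<phi>_sum[OF a x] by (simp add: e D_def unified_cobracket_def Let_def S_def)
    finally show ?thesis ..
  qed

  \<comment> \<open>Transport of the Lie coalgebra axioms and the isomorphism\<close>
  have D: "lie_coalgebra K S D"
    using D_eq \<phi>_bij unfolding \<phi>2_def
    by (intro lie_coalgebra_transport[OF \<open>lie_coalgebra K E \<delta>\<^sub>E\<close> S \<phi>]) (auto simp: bij_betw_def)
  have "lie_coalgebraic_extending_structure K \<gg> \<delta>\<^sub>G \<vv> \<Delta>E \<Delta>V \<delta>V"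
    using \<open>lie_coalgebra K \<gg> \<delta>\<^sub>G\<close> datum D
    by (simp add: lie_coalgebraic_extending_structure_def S_def D_def)
  \<comment> \<open>The homomorphism condition is \<open>D_eq\<close> again, the same equation that
    drove the transport.\<close>
  moreover have "lie_coalgebra_iso K E \<delta>\<^sub>E S D \<phi>"
    using \<open>lie_coalgebra K E \<delta>\<^sub>E\<close> D linear_mapI[OF E S \<phi>] D_eq \<phi>_bij
    by (simp add: lie_coalgebra_iso_def lie_coalgebra_iso_axioms_def lie_coalgebra_hom_def
        lie_coalgebra_hom_axioms_def \<phi>2_def)
  ultimately show ?thesis
    using \<phi>_G unfolding S_def D_def by blast
qed

end
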